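(* For $n\geq 3$, the function $J\colon \mathcal{AC}_n\to(0,\infty)$ that records circumcircle radius is smooth and symmetric. For $\mathbf{d}=(d_0,\ldots,d_{n-1})\in\mathcal{AC}_n$: $$\begin{cases} 0<\frac{\partial J}{\partial d_i}(\mathbf{d})<\frac12 & \text{if } \mathbf{d}\in\mathcal{C}_n,\ \text{for any } i,\\ \frac{\partial J}{\partial d_{i_0}}(\mathbf{d})>\frac12 & \text{if } \mathbf{d}\in\mathcal{AC}_n-(\mathcal{C}_n\cup\mathcal{BC}_n)\ \text{and}\ d_{i_0}=\max\{d_i\}_{i=0}^{n-1},\\ \frac{\partial J}{\partial d_j}(\mathbf{d})<0 & \text{if } \mathbf{d}\in\mathcal{AC}_n-(\mathcal{C}_n\cup\mathcal{BC}_n)\ \text{and}\ d_j\neq\max\{d_i\}_{i=0}^{n-1}.\end{cases}$$ Furthermore, if $d_i>d_j$ then $\left|\frac{\partial J}{\partial d_i}(\mathbf{d})\right|>\left|\frac{\partial J}{\partial d_j}(\mathbf{d})\right|$.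
   Context: For $d>0$ and $J\geq d/2$ let $\theta(d,J)=2\sin^{-1}(\sinh(d/2)/\sinh J)\in[0,\pi]$. Define $$\mathcal{AC}_n=\Big\{(d_0,\ldots,d_{n-1})\in(0,\infty)^n : \sinh(d_i/2)<\sum_{j\neq i}\sinh(d_j/2)\text{ for each } i\Big\},$$ $$\mathcal{C}_n=\Big\{(d_0,\ldots,d_{n-1})\in(0,\infty)^n : \sum_{i=0}^{n-1}\theta(d_i,D/2)>2\pi,\ D=\max_i d_i\Big\},$$ $$\mathcal{BC}_n=\Big\{(d_0,\ldots,d_{n-1})\in(0,\infty)^n : \sum_{i=0}^{n-1}\theta(d_i,D/2)=2\pi,\ D=\max_i d_i\Big\}.$$ Both $\mathcal{C}_n$ and $\mathcal{BC}_n$ are subsets of $\mathcal{AC}_n$. A cyclic $n$-gon in the hyperbolic plane $\mathbb{H}^2$ with side length collection $(d_0,\ldots,d_{n-1})$ is a set $\{x_0,\ldots,x_{n-1}\}$ of points on a hyperbolic metric circle (its circumcircle), cyclically ordered counterclockwise (for each $i$ with $1\le i\le n-1$, the counterclockwise half-open arc $(x_{i-1},x_i]$ contains no $x_j$ with $j\neq i$), such that $\mathrm{dist}(x_{i-1},x_i)=d_i$ for $i>0$ and $\mathrm{dist}(x_{n-1},x_0)=d_0$. The set $\mathcal{AC}_n$ is exactly the set of side length collections of cyclic $n$-gons, and a cyclic $n$-gon is determined up to isometry of $\mathbb{H}^2$ by its side length collection; $J(\mathbf{d})$ is the (hyperbolic) radius of the circumcircle of a cyclic $n$-gon with side length collection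 $\mathbf{d}$. A function is symmetric if it is invariant under all permutations of its arguments.
   Formalization: In the last sentence, strict inequality is asserted only when d is not in BC_n or d_i is the maximal entry; otherwise (d in BC_n, d_i not maximal) only ≥ is asserted, since both partial derivatives then vanish and the strict claim is false. *)

theory Defs
  imports "HOL-Analysis.Analysis"
begin

subsection \<open>The hyperbolic plane\<close>

text \<open>The Poincare disc model of curvature -1.\<close>

definition hyp_plane :: "complex set" where
  "hyp_plane = {z. norm z < 1}"

definition hyp_dist :: "complex \<Rightarrow> complex \<Rightarrow> real" where
  "hyp_dist z w = arcosh (1 + 2 * (norm (z - w))\<^sup>2 / ((1 - (norm z)\<^sup>2) * (1 - (norm w)\<^sup>2)))"

definition hyp_circle :: "complex \<Rightarrow> real \<Rightarrow> complex set" where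
  "hyp_circle c r = {z \<in> hyp_plane. hyp_dist c z = r}"

text \<open>The orientation-preserving isometry of the disc that takes \<open>c\<close> to the origin.\<close>

definition hyp_centre :: "complex \<Rightarrow> complex \<Rightarrow> complex" where
  "hyp_centre c z = (z - c) / (1 - cnj c * z)"

text \<open>
  The half-open counterclockwise arc \<open>(x, y]\<close> of the circle centred at \<open>c\<close> through \<open>x\<close> and \<open>y\<close>.
  After \<open>c\<close> is moved to the origin, the hyperbolic rotations about \<open>c\<close> are multiplications
  by \<open>cis \<alpha>\<close>. The arc is empty if \<open>x = y\<close>, which does not occur for a polygon with positive
  side lengths.
\<close>

definition ccw_arc :: "complex \<Rightarrow> complex \<Rightarrow> complex \<Rightarrow> complex set" where
  "ccw_arc c x y = {z \<in> hyp_plane. \<exists>\<alpha> \<beta>. 0 < \<alpha> \<and> \<alpha> \<le> \<beta> \<and> \<beta> < 2 * pi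
     \<and> hyp_centre c z = cis \<alpha> * hyp_centre c x
     \<and> hyp_centre c y = cis \<beta> * hyp_centre c x}"

subsection \<open>Cyclic polygons\<close>

text \<open>
  \<open>x 0, \<dots>, x (n - 1)\<close> are the vertices of a cyclic \<open>n\<close>-gon with side length collection
  \<open>(d 0, \<dots>, d (n - 1))\<close> whose circumcircle has centre \<open>c\<close> and radius \<open>r\<close>.
\<close>

definition cyclic_ngon ::
    "nat \<Rightarrow> (nat \<Rightarrow> real) \<Rightarrow> complex \<Rightarrow> real \<Rightarrow> (nat \<Rightarrow> complex) \<Rightarrow> bool" where
  "cyclic_ngon n d c r x \<longleftrightarrow>
     c \<in> hyp_plane \<and> 0 < r \<and> (\<forall>i<n. x i \<in> hyp_circle c r)
     \<and> (\<forall>i\<in>{1..<n}. \<forall>j<n. j \<noteq> i \<longrightarrow> x j \<notin> ccw_arc c (x (i - 1)) (x i))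
     \<and> (\<forall>i\<in>{1..<n}. hyp_dist (x (i - 1)) (x i) = d i)
     \<and> hyp_dist (x (n - 1)) (x 0) = d 0"

text \<open>
  A collection \<open>(d\<^sub>0, \<dots>, d\<^sub>n\<^sub>-\<^sub>1)\<close> is a vector \<open>d :: real ^ 'n\<close> with \<open>CARD('n) = n\<close>, where
  a bijection \<open>e\<close> from \<open>{..<n}\<close> to \<open>'n\<close> supplies the numbering of the entries,
  \<open>d\<^sub>k = d $ e k\<close>. Only the cyclic order of the sides depends on the numbering.
\<close>

definition is_circumradius :: "(nat \<Rightarrow> 'n::finite) \<Rightarrow> real ^ 'n \<Rightarrow> real \<Rightarrow> bool" where
  "is_circumradius e d r \<longleftrightarrow> (\<exists>c x. cyclic_ngon CARD('n) (\<lambda>k. d $ e k) c r x)"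

definition J :: "(nat \<Rightarrow> 'n::finite) \<Rightarrow> real ^ 'n \<Rightarrow> real" where
  "J e d = (THE r. is_circumradius e d r)"

subsection \<open>Spaces of side length collections\<close>

definition theta :: "real \<Rightarrow> real \<Rightarrow> real" where
  "theta d r = 2 * arcsin (sinh (d / 2) / sinh r)"

definition max_side :: "real ^ 'n::finite \<Rightarrow> real" where
  "max_side d = Max (range (\<lambda>i. d $ i))"

definition AC :: "(real ^ 'n::finite) set" where
  "AC = {d. (\<forall>i. 0 < d $ i) \<and> (\<forall>i. sinh (d $ i / 2) < (\<Sum>j\<in>UNIV - {i}. sinh (d $ j / 2)))}"

definition C :: "(real ^ 'n::finite) set" where
  "C = {d. (\<forall>i. 0 < d $ i) \<and> (\<Sum>i\<in>UNIV. theta (d $ i) (max_side d / 2)) > 2 * pi}"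

definition BC :: "(real ^ 'n::finite) set" where
  "BC = {d. (\<forall>i. 0 < d $ i) \<and> (\<Sum>i\<in>UNIV. theta (d $ i) (max_side d / 2)) = 2 * pi}"

subsection \<open>Smoothness and partial derivatives\<close>

text \<open>\<open>k\<close>-fold continuous differentiability; intended for open \<open>S\<close>.\<close>

primrec Ck_on :: "nat \<Rightarrow> 'a::real_normed_vector set \<Rightarrow> ('a \<Rightarrow> 'b::real_normed_vector) \<Rightarrow> bool" where
  "Ck_on 0 S f \<longleftrightarrow> continuous_on S f"
| "Ck_on (Suc k) S f \<longleftrightarrow>
     (\<forall>x\<in>S. f differentiable (at x)) \<and> (\<forall>v. Ck_on k S (\<lambda>x. frechet_derivative f (at x) v))"

definition smooth_on :: "'a::real_normed_vector set \<Rightarrow> ('a \<Rightarrow> 'b::real_normed_vector) \<Rightarrow> bool" where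
  "smooth_on S f \<longleftrightarrow> (\<forall>k. Ck_on k S f)"

definition partial_deriv :: "'n::finite \<Rightarrow> (real ^ 'n \<Rightarrow> real) \<Rightarrow> real ^ 'n \<Rightarrow> real" where
  "partial_deriv i f x = deriv (\<lambda>t. f (x + t *\<^sub>R axis i 1)) 0"

end

theory Submission imports Defs begin

text \<open>
  A chord of length \<open>d\<close> in a hyperbolic circle of radius \<open>r\<close> that subtends the central angle
  \<open>2 t\<close> satisfies \<open>sinh (d / 2) = sinh r * sin t\<close>. With \<open>a\<^sub>i = sinh (d\<^sub>i / 2)\<close> and \<open>R = sinh r\<close>
  the problem becomes Euclidean: find \<open>R > 0\<close> and \<open>t\<^sub>i \<in> (0, \<pi>)\<close> with
  \<open>a\<^sub>i = R sin t\<^sub>i\<close> and \<open>\<Sum> t\<^sub>i = \<pi>\<close>. At most one \<open>t\<^sub>m\<close> is not acute, and then \<open>a\<^sub>m\<close> is the largest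
  side. Existence follows from the intermediate value theorem applied to a sum of arcsines in
  \<open>1 / R\<close>; the two cases of that argument (all angles acute, or one obtuse) are what separates
  \<open>C\<close> from the complement of \<open>C \<union> BC\<close>. Uniqueness follows from the strict subadditivity of
  \<open>arcsin \<circ> (\<lambda> sin)\<close> for \<open>\<lambda> < 1\<close>. Differentiating \<open>a\<^sub>i = R sin t\<^sub>i\<close> and \<open>\<Sum> t\<^sub>i = \<pi>\<close> gives
  \<open>R' E = a'\<^sub>m + cos t\<^sub>m \<Sum>\<^sub>j a'\<^sub>j / cos t\<^sub>j\<close>, where \<open>E = sin t\<^sub>m + cos t\<^sub>m \<Sum>\<^sub>j tan t\<^sub>j > 0\<close> and \<open>j\<close> ranges
  over the indices other than \<open>m\<close>. This form stays regular at \<open>t\<^sub>m = \<pi> / 2\<close>; the sign and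
  size of the partial derivatives can be read off from it.
\<close>

section \<open>Uniqueness of inscribed polygons\<close>

lemma sin_add_shrink:
  fixes x x' y y' l :: real
  assumes "0 < l" "0 < x'" "x' < x" "0 < y'" "y' < y" "x + y \<le> pi" "x' + y' \<le> pi / 2"
    and sx: "l * sin x \<le> sin x'" and sy: "l * sin y \<le> sin y'"
  shows "l * sin (x + y) < sin (x' + y')"
proof -
  have "sin x > 0" "sin y > 0"
    using assms by (auto intro!: sin_gt_zero)
  have cx: "cos x < cos x'" and cy: "cos y < cos y'"
    using assms by (auto intro!: cos_monotone_0_pi)
  have "0 \<le> cos x'" "0 \<le> cos y'"
    using assms by (auto intro!: cos_ge_zero)
  have "l * sin (x + y) = (l * sin x) * cos y + (l * sin y) * cos x"
    by (simp add: sin_add algebra_simps)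
  \<comment> \<open>The cosines are exchanged first, against the positive factors
    \<open>l * sin x\<close> and \<open>l * sin y\<close>: \<open>cos x\<close> and
    \<open>cos y\<close> may be negative, while \<open>cos x'\<close> and \<open>cos y'\<close> are
    not and can carry the sine bounds in the next step.\<close>
  also have "\<dots> < (l * sin x) * cos y' + (l * sin y) * cos x'"
    using \<open>sin x > 0\<close> \<open>sin y > 0\<close> cx cy \<open>0 < l\<close> by (intro add_strict_mono mult_strict_left_mono) auto
  also have "\<dots> \<le> sin x' * cos y' + sin y' * cos x'"
    using \<open>0 \<le> cos x'\<close> \<open>0 \<le> cos y'\<close> sx sy by (intro add_mono mult_right_mono) auto
  finally show ?thesis
    by (simp add: sin_add algebra_simps)
qed

text \<open>Angles are added one at a time by \<open>sin_add_shrink\<close>. A single angle has only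
  the weak bound that is assumed; each addition makes it strict, hence the clause on
  \<open>card A\<close>.\<close>

lemma sin_sum_shrink:
  fixes t t' :: "'a \<Rightarrow> real"
  assumes "finite A" "A \<noteq> {}" "0 < l"
    and t: "\<And>j. j \<in> A \<Longrightarrow> 0 < t' j \<and> t' j < t j \<and> l * sin (t j) \<le> sin (t' j)"
    and "sum t A \<le> pi" "sum t' A \<le> pi / 2"
  shows "l * sin (sum t A) \<le> sin (sum t' A) \<and> (card A \<ge> 2 \<longrightarrow> l * sin (sum t A) < sin (sum t' A))"
  using assms(1,2) t assms(5,6)
proof (induction A rule: finite_ne_induct)
  case (singleton x)
  then show ?case by simp
next
  case (insert x F)
  have "0 < t' x" "t' x < t x" and tx: "l * sin (t x) \<le> sin (t' x)"
    using insert.prems(1)[of x] by auto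
  have "0 < sum t' F" "sum t' F < sum t F"
    using insert by (auto intro!: sum_pos sum_strict_mono)
  moreover have "sum t F \<le> pi" "sum t' F \<le> pi / 2"
    using insert.prems(2,3) insert.hyps \<open>0 < t' x\<close> \<open>t' x < t x\<close> by auto
  then have "l * sin (sum t F) \<le> sin (sum t' F)"
    using insert by auto
  ultimately have "l * sin (t x + sum t F) < sin (t' x + sum t' F)"
    using insert.prems(2,3) insert.hyps \<open>0 < t' x\<close> \<open>t' x < t x\<close> tx \<open>0 < l\<close>
    by (intro sin_add_shrink) auto
  then show ?case
    using insert.hyps by simp
qed

text \<open>Needed for the positivity of the denominator in the derivative of the radius. A single
  angle gives equality, and every further angle adds a positive amount to the gap.\<close>

lemma cos_mult_sum_tan:
  fixes t :: "'a \<Rightarrow> real"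
  assumes "finite A" "A \<noteq> {}" and t: "\<And>j. j \<in> A \<Longrightarrow> 0 < t j \<and> t j < pi / 2"
    and "sum t A < pi"
  shows "cos (sum t A) * (\<Sum>j\<in>A. tan (t j)) \<le> sin (sum t A)
     \<and> (card A \<ge> 2 \<longrightarrow> cos (sum t A) * (\<Sum>j\<in>A. tan (t j)) < sin (sum t A))"
  using assms
proof (induction A rule: finite_ne_induct)
  case (singleton x)
  then show ?case
    using cos_gt_zero[of "t x"] by (simp add: tan_def)
next
  case (insert x F)
  define S T c s where "S = sum t F" and "T = (\<Sum>j\<in>F. tan (t j))"
    and "c = cos (t x)" and "s = sin (t x)"
  have x: "0 < t x" "t x < pi / 2"
    using insert.prems(1)[of x] by auto
  have "t x + sum t F < pi"
    using insert.hyps insert.prems(2) by simp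
  moreover have "0 < S"
    using insert.hyps insert.prems unfolding S_def by (auto intro!: sum_pos)
  ultimately have "0 < S" "S < pi"
    using x by (simp_all add: S_def)
  then have "0 < sin S"
    by (intro sin_gt_zero)
  have "0 < T"
    using insert unfolding T_def by (intro sum_pos tan_gt_zero) auto
  have "0 < c" "0 < s"
    using x unfolding c_def s_def by (auto intro!: sin_gt_zero cos_gt_zero)
  have IH: "cos S * T \<le> sin S"
    using insert.IH insert.prems \<open>S < pi\<close> unfolding S_def T_def by auto
  \<comment> \<open>By the addition formulas the new gap is \<open>c\<close> times the old one plus
    a positive remainder, whatever the sign of \<open>cos S\<close>.\<close>
  have "sin (t x + S) - cos (t x + S) * (tan (t x) + T)
      = c * (sin S - cos S * T) + s * sin S * (T + s / c)"
    using \<open>0 < c\<close> unfolding sin_add cos_add tan_def c_def[symmetric] s_def[symmetric]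
    by (simp add: field_simps)
  moreover have "c * (sin S - cos S * T) \<ge> 0" "s * sin S * (T + s / c) > 0"
    using IH \<open>0 < c\<close> \<open>0 < s\<close> \<open>0 < sin S\<close> \<open>0 < T\<close> by (simp_all add: add_pos_pos)
  ultimately have "cos (t x + S) * (tan (t x) + T) < sin (t x + S)"
    by linarith
  then show ?case
    using insert.hyps by (simp add: S_def T_def)
qed

text \<open>Half side lengths, circumradius and half central angles of a Euclidean polygon in a
  circle. The bound \<pi> instead of \<pi>/2 allows the centre to lie beyond the longest side; the
  sum \<pi> says that the polygon winds around once.\<close>

definition inscribed :: "real ^ 'n::finite \<Rightarrow> real \<Rightarrow> ('n \<Rightarrow> real) \<Rightarrow> bool" where
  "inscribed a R t \<longleftrightarrow> 0 < R \<and> (\<forall>i. 0 < t i \<and> t i < pi) \<and> sum t UNIV = pi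
     \<and> (\<forall>i. a $ i = R * sin (t i))"

lemma inscribedD:
  assumes "inscribed a R t"
  shows "0 < R" "0 < t i" "t i < pi" "sum t UNIV = pi" "a $ i = R * sin (t i)" "0 < sin (t i)"
    "0 < a $ i" "sum t (UNIV - {i}) = pi - t i"
  using assms sum.remove[of UNIV i t] unfolding inscribed_def
  by (auto intro: sin_gt_zero intro!: mult_pos_pos)

text \<open>A third angle takes a positive share of the total \<pi>. Hence at most one angle fails
  to be acute.\<close>

lemma inscribed_add_less:
  fixes a :: "real ^ 'n::finite"
  assumes "inscribed a R t" "CARD('n) \<ge> 3" "i \<noteq> j"
  shows "t i + t j < pi"
proof -
  obtain k where k: "k \<noteq> i" "k \<noteq> j"
  proof -
    have "UNIV \<noteq> {i, j}"
      using assms(2,3) by (metis card_2_iff Suc_n_not_le_n numeral_2_eq_2 numeral_3_eq_3)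
    then show ?thesis using that by auto
  qed
  have "t i + t j + t k = sum t {i, j, k}"
    using k assms(3) by auto
  also have "\<dots> \<le> sum t UNIV"
    by (rule sum_mono2) (use inscribedD(2)[OF assms(1)] in \<open>auto intro: less_imp_le\<close>)
  finally show ?thesis
    using inscribedD(2)[OF assms(1), of k] inscribedD(4)[OF assms(1)] by auto
qed

lemma card_UNIV_minus_ge_2:
  assumes "CARD('n::finite) \<ge> 3"
  shows "card (UNIV - {m :: 'n}) \<ge> 2" "UNIV - {m} \<noteq> {}"
proof -
  show *: "card (UNIV - {m}) \<ge> 2"
    using assms by (simp add: card_Diff_singleton)
  show "UNIV - {m} \<noteq> {}"
    using * by (metis card.empty not_numeral_le_zero)
qed

text \<open>If \<open>R < R'\<close>, all sines shrink by \<open>l = R / R'\<close>, so every angle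
  \<open>t' i\<close> up to \<pi>/2 is smaller than \<open>t i\<close>. Without an obtuse
  \<open>t' m\<close> the totals cannot both be \<pi>; with one, the remaining angles violate
  \<open>sin_sum_shrink\<close>.\<close>

lemma inscribed_radius_le:
  fixes a :: "real ^ 'n::finite"
  assumes n: "CARD('n) \<ge> 3" and t: "inscribed a R t" and t': "inscribed a R' t'"
  shows "R' \<le> R"
proof (rule ccontr)
  assume "\<not> R' \<le> R"
  define l where "l = R / R'"
  have R: "0 < R" "0 < R'" "R < R'"
    using inscribedD(1)[OF t] inscribedD(1)[OF t'] \<open>\<not> R' \<le> R\<close> by auto
  then have l: "0 < l" "l < 1"
    by (auto simp: l_def)
  have sin_t': "sin (t' i) = l * sin (t i)" for i
    using inscribedD(5)[OF t, of i] inscribedD(5)[OF t', of i] R by (simp add: l_def field_simps)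
  have less: "t' i < t i" if "t' i \<le> pi / 2" for i
  proof (rule ccontr)
    assume "\<not> t' i < t i"
    then have "sin (t i) \<le> sin (t' i)"
      using that inscribedD(2)[OF t, of i] by (intro sin_monotone_2pi_le) auto
    moreover have "l * sin (t i) < sin (t i)"
      using l inscribedD(6)[OF t, of i] by simp
    ultimately show False
      using sin_t'[of i] by simp
  qed
  show False
  proof (cases "\<forall>i. t' i \<le> pi / 2")
    case True
    then have "sum t' UNIV < sum t UNIV"
      using less by (intro sum_strict_mono) auto
    then show False
      using inscribedD(4)[OF t] inscribedD(4)[OF t'] by simp
  next
    case False
    then obtain m where m: "t' m > pi / 2"
      by (auto simp: not_le)
    have "t' j < pi / 2" if "j \<noteq> m" for j
      using inscribed_add_less[OF t' n that] m by simp
    moreover have card: "card (UNIV - {m}) \<ge> 2" "UNIV - {m} \<noteq> {}"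
      using card_UNIV_minus_ge_2[OF n] by auto
    \<comment> \<open>The two sums are \<open>pi - t m\<close> and \<open>pi - t' m\<close>, with
      the same sines as \<open>t m\<close> and \<open>t' m\<close>; so strictness contradicts
      \<open>sin_t'\<close> at \<open>m\<close>.\<close>
    ultimately have "l * sin (sum t (UNIV - {m})) < sin (sum t' (UNIV - {m}))"
      using sin_sum_shrink[of "UNIV - {m}" l t' t] card less sin_t' l(1) m
      by (simp add: inscribedD(2,8)[OF t] inscribedD(2,8)[OF t'] less_imp_le)
    then show False
      using sin_t'[of m] by (simp add: inscribedD(8)[OF t] inscribedD(8)[OF t'])
  qed
qed

text \<open>Equal radii give equal sines, so angles agree or are supplementary. If
  \<open>t' i\<close> exceeds \<open>t i\<close>, the two are supplementary; by
  \<open>inscribed_add_less\<close> no second pair can be, so all other angles agree and the totals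
  differ.\<close>

lemma inscribed_angle_le:
  fixes a :: "real ^ 'n::finite"
  assumes n: "CARD('n) \<ge> 3" and t: "inscribed a R t" and t': "inscribed a R t'"
  shows "t' i \<le> t i"
proof (rule ccontr)
  assume less: "\<not> t' i \<le> t i"
  have sin_eq: "sin (t' j) = sin (t j)" for j
    using inscribedD(1)[OF t] inscribedD(5)[OF t, of j] inscribedD(5)[OF t', of j] by simp
  have cases: "t' j = t j \<or> t' j = pi - t j" for j
  proof -
    have "0 < t j" "t j < pi" "0 < t' j" "t' j < pi"
      using inscribedD(2,3)[OF t, of j] inscribedD(2,3)[OF t', of j] by auto
    note range = this
    show ?thesis
    proof (cases "t j \<le> pi / 2")
      case True
      then show ?thesis
        using range sin_inj_pi[of "t' j" "t j"] sin_inj_pi[of "pi - t' j" "t j"] sin_eq[of j]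
        by (cases "t' j \<le> pi / 2") simp_all
    next
      case False
      then show ?thesis
        using range sin_inj_pi[of "t' j" "pi - t j"] sin_inj_pi[of "pi - t' j" "pi - t j"]
          sin_eq[of j]
        by (cases "t' j \<le> pi / 2") simp_all
    qed
  qed
  have i: "t' i = pi - t i" "t' i > pi / 2"
    using cases[of i] less by auto
  have "t' j = t j" if "j \<noteq> i" for j
    using cases[of j] inscribed_add_less[OF t n that] inscribed_add_less[OF t' n that] i
    by auto
  then have "sum t' (UNIV - {i}) = sum t (UNIV - {i})"
    by simp
  then show False
    using less by (simp add: inscribedD(8)[OF t] inscribedD(8)[OF t'])
qed

lemma inscribed_unique:
  fixes a :: "real ^ 'n::finite"
  assumes "CARD('n) \<ge> 3" "inscribed a R t" "inscribed a R' t'"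
  shows "R' = R \<and> t' = t"
proof -
  have "R' = R"
    using inscribed_radius_le[OF assms] inscribed_radius_le[OF assms(1,3,2)] by simp
  then show ?thesis
    using inscribed_angle_le assms by (metis (no_types) ext order_antisym)
qed

text \<open>A non-acute \<open>t j\<close> would force \<open>t m < pi - t j \<le> pi / 2\<close>,
  hence a larger sine at \<open>j\<close> than at \<open>m\<close>.\<close>

lemma inscribed_max_acute:
  fixes a :: "real ^ 'n::finite"
  assumes n: "CARD('n) \<ge> 3" and t: "inscribed a R t" and m: "\<And>i. a $ i \<le> a $ m" and "j \<noteq> m"
  shows "t j < pi / 2"
proof (rule ccontr)
  assume j: "\<not> t j < pi / 2"
  have "t m < pi - t j"
    using inscribed_add_less[OF t n \<open>j \<noteq> m\<close>] by simp
  then have "sin (t m) < sin (pi - t j)"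
    using j inscribedD(2)[OF t, of m] by (intro sin_monotone_2pi) auto
  then have "a $ m < a $ j"
    using inscribedD(1)[OF t] by (simp add: inscribedD(5)[OF t])
  then show False
    using m[of j] by simp
qed

text \<open>The angles other than \<open>t m\<close> add up to \<open>pi - t m\<close>, whose cosine
  is \<open>- cos (t m)\<close>; this turns \<open>cos_mult_sum_tan\<close> into the claim.\<close>

lemma inscribed_denominator_pos:
  fixes a :: "real ^ 'n::finite"
  assumes n: "CARD('n) \<ge> 3" and t: "inscribed a R t" and "\<And>j. j \<noteq> m \<Longrightarrow> t j < pi / 2"
  shows "sin (t m) + cos (t m) * (\<Sum>j\<in>UNIV - {m}. tan (t j)) > 0"
proof -
  have "sum t (UNIV - {m}) = pi - t m" "0 < t m"
    using inscribedD[OF t] by auto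
  then show ?thesis
    using cos_mult_sum_tan[of "UNIV - {m}" t] card_UNIV_minus_ge_2[OF n, of m] assms(3)
      inscribedD(2)[OF t]
    by simp
qed

section \<open>Existence of inscribed polygons\<close>

text \<open>Intermediate values in \<open>u = 1 / R\<close>: the sum of the arcsines is 0 at
  \<open>u = 0\<close> and exceeds \<pi> at \<open>u = 1 / a $ m\<close>, the last point where all
  of them are defined.\<close>

lemma inscribed_exists_acute:
  fixes a :: "real ^ 'n::finite"
  assumes pos: "\<And>i. 0 < a $ i" and m: "\<And>i. a $ i \<le> a $ m"
    and F: "(\<Sum>i\<in>UNIV. arcsin (a $ i / a $ m)) > pi"
  shows "\<exists>R t. inscribed a R t \<and> t m < pi / 2"
proof -
  define A where "A = a $ m"
  have A: "0 < A" "\<And>i. a $ i \<le> A"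
    using pos m by (auto simp: A_def)
  define f where "f u = (\<Sum>i\<in>UNIV. arcsin (a $ i * u))" for u
  have bd: "0 \<le> a $ i * u" "a $ i * u \<le> 1" if "0 \<le> u" "u \<le> 1 / A" for u i
  proof -
    show "0 \<le> a $ i * u"
      using pos[of i] that by simp
    have "a $ i * u \<le> A * (1 / A)"
      using that A pos[of i] by (intro mult_mono) auto
    then show "a $ i * u \<le> 1"
      using A by simp
  qed
  have "continuous_on {0..1/A} f"
    unfolding f_def using bd by (intro continuous_intros) (auto intro: order_trans[of _ 0])
  moreover have "f 0 \<le> pi" "pi \<le> f (1 / A)"
    using F by (auto simp: f_def A_def)
  ultimately obtain u where u: "0 \<le> u" "u \<le> 1 / A" "f u = pi"
    using IVT'[of f 0 pi "1 / A"] A by auto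
  \<comment> \<open>Excluding the right endpoint makes the angle at \<open>m\<close> strictly
    acute.\<close>
  have "u \<noteq> 0" "u \<noteq> 1 / A"
    using u(3) F by (auto simp: f_def A_def)
  with u have u': "0 < u" "u < 1 / A" by auto
  have arg: "0 < a $ i * u" "a $ i * u \<le> 1" for i
    using pos[of i] u' bd[of u i] by auto
  have "inscribed a (1 / u) (\<lambda>i. arcsin (a $ i * u))"
    unfolding inscribed_def
  proof (intro conjI allI)
    show "sum (\<lambda>i. arcsin (a $ i * u)) UNIV = pi"
      using u(3) by (simp add: f_def)
    fix i
    show "0 < arcsin (a $ i * u)"
      using arcsin_less_arcsin[of 0 "a $ i * u"] arg[of i] by simp
    show "arcsin (a $ i * u) < pi"
      using arcsin_ubound[of "a $ i * u"] arg[of i] pi_gt_zero by linarith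
    show "a $ i = 1 / u * sin (arcsin (a $ i * u))"
      using arg[of i] u' by (simp add: sin_arcsin)
  qed (use u' in simp)
  moreover have "a $ m * u < 1"
    using u' A by (simp add: A_def field_simps)
  then have "arcsin (a $ m * u) < pi / 2"
    using arcsin_less_arcsin[of "a $ m * u" 1] arg[of m] by simp
  ultimately show ?thesis by blast
qed

text \<open>In this borderline case the longest side is a diameter.\<close>

lemma inscribed_exists_right:
  fixes a :: "real ^ 'n::finite"
  assumes pos: "\<And>i. 0 < a $ i" and m: "\<And>i. a $ i \<le> a $ m"
    and F: "(\<Sum>i\<in>UNIV. arcsin (a $ i / a $ m)) = pi"
  shows "\<exists>R t. inscribed a R t \<and> t m = pi / 2"
proof -
  have arg: "0 < a $ i / a $ m" "a $ i / a $ m \<le> 1" for i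
    using pos[of i] pos[of m] m[of i] by auto
  have "inscribed a (a $ m) (\<lambda>i. arcsin (a $ i / a $ m))"
    unfolding inscribed_def
  proof (intro conjI allI)
    fix i
    show "0 < arcsin (a $ i / a $ m)"
      using arcsin_less_arcsin[of 0 "a $ i / a $ m"] arg[of i] by simp
    show "arcsin (a $ i / a $ m) < pi"
      using arcsin_ubound[of "a $ i / a $ m"] arg[of i] pi_gt_zero by linarith
    show "a $ i = a $ m * sin (arcsin (a $ i / a $ m))"
      using arg[of i] pos[of m] by (simp add: sin_arcsin)
  qed (use pos F in simp_all)
  moreover have "arcsin (a $ m / a $ m) = pi / 2"
    using pos[of m] by simp
  ultimately show ?thesis by blast
qed

text \<open>With \<open>pi - arcsin (A * u)\<close> as the angle at \<open>m\<close>, the total is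
  \<pi> exactly when \<open>g u = 0\<close>. The polygon inequality is the positivity of the
  derivative of \<open>g\<close> at 0; at \<open>1 / A\<close> the angle at \<open>m\<close> is
  right and the others add up to less than \<pi>/2.\<close>

lemma inscribed_exists_obtuse:
  fixes a :: "real ^ 'n::finite"
  assumes pos: "\<And>i. 0 < a $ i" and m: "\<And>i. a $ i \<le> a $ m"
    and poly: "a $ m < (\<Sum>j\<in>UNIV - {m}. a $ j)"
    and F: "(\<Sum>i\<in>UNIV. arcsin (a $ i / a $ m)) < pi"
  shows "\<exists>R t. inscribed a R t \<and> t m > pi / 2"
proof -
  define A where "A = a $ m"
  have A: "0 < A" "\<And>i. a $ i \<le> A"
    using pos m by (auto simp: A_def)
  define g where "g u = (\<Sum>j\<in>UNIV - {m}. arcsin (a $ j * u)) - arcsin (A * u)" for u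
  have bd: "0 \<le> a $ i * u" "a $ i * u \<le> 1" if "0 \<le> u" "u \<le> 1 / A" for u i
  proof -
    show "0 \<le> a $ i * u"
      using pos[of i] that by simp
    have "a $ i * u \<le> A * (1 / A)"
      using that A pos[of i] by (intro mult_mono) auto
    then show "a $ i * u \<le> 1"
      using A by simp
  qed
  have "(g has_real_derivative (\<Sum>j\<in>UNIV - {m}. a $ j) - A) (at 0)"
    unfolding g_def by (auto intro!: derivative_eq_intros)
  then obtain e where e: "0 < e" "\<And>h. 0 < h \<Longrightarrow> h < e \<Longrightarrow> g 0 < g h"
    using DERIV_pos_inc_right[of g "(\<Sum>j\<in>UNIV - {m}. a $ j) - A" 0] poly unfolding A_def
    by auto
  \<comment> \<open>The trivial zero \<open>u = 0\<close> corresponds to an infinite radius, so the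
    search for a zero starts at a point \<open>v\<close> where \<open>g\<close> is already
    positive.\<close>
  define v where "v = min (e / 2) (1 / A)"
  have v: "0 < v" "v \<le> 1 / A" "0 < g v"
    using e(1) e(2)[of v] A by (auto simp: v_def g_def min_def)
  have "continuous_on {v..1/A} g"
    unfolding g_def using bd v A
    by (intro continuous_intros) (auto simp: A_def intro: order_trans[of _ 0])
  moreover have g1: "g (1 / A) < 0"
    using F A sum.remove[of UNIV m "\<lambda>i. arcsin (a $ i / a $ m)"] by (simp add: g_def A_def)
  ultimately obtain u where u: "v \<le> u" "u \<le> 1 / A" "g u = 0"
    using IVT2'[of g "1 / A" 0 v] v by auto
  have "u \<noteq> 1 / A"
    using u(3) g1 by auto
  with u v have u': "0 < u" "u < 1 / A" by auto
  have arg: "0 < a $ i * u" "a $ i * u \<le> 1" for i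
    using pos[of i] u' bd[of u i] by auto
  have am: "a $ m * u < 1"
    using u' A by (simp add: A_def field_simps)
  define t where "t i = (if i = m then pi - arcsin (a $ m * u) else arcsin (a $ i * u))" for i
  have ar: "0 < arcsin (a $ i * u)" "arcsin (a $ i * u) < pi" for i
    using arcsin_less_arcsin[of 0 "a $ i * u"] arg[of i] arcsin_ubound[of "a $ i * u"] pi_gt_zero
    by (simp, linarith)
  have "inscribed a (1 / u) t"
    unfolding inscribed_def
  proof (intro conjI allI)
    show "sum t UNIV = pi"
      using u(3) sum.remove[of UNIV m t] by (simp add: g_def A_def t_def)
    fix i
    show "0 < t i" "t i < pi"
      using ar[of i] by (auto simp: t_def)
    show "a $ i = 1 / u * sin (t i)"
      using arg[of i] arg[of m] u' by (simp add: t_def sin_arcsin)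
  qed (use u' in simp)
  moreover have "t m > pi / 2"
    using arcsin_less_arcsin[of "a $ m * u" 1] arg[of m] am by (simp add: t_def)
  ultimately show ?thesis by blast
qed

section \<open>Existence in general, and the type of the largest angle\<close>

lemma ex_maximal_index:
  fixes f :: "'n::finite \<Rightarrow> real"
  shows "\<exists>m. \<forall>i. f i \<le> f m"
proof -
  have "Max (range f) \<in> range f"
    by (rule Max_in) auto
  then obtain m where "Max (range f) = f m"
    by blast
  moreover have "f i \<le> Max (range f)" for i
    by (rule Max_ge) auto
  ultimately show ?thesis
    by auto
qed

lemma inscribed_exists:
  fixes a :: "real ^ 'n::finite"
  assumes pos: "\<And>i. 0 < a $ i" and poly: "\<And>i. a $ i < (\<Sum>j\<in>UNIV - {i}. a $ j)"
  shows "\<exists>R t. inscribed a R t"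
proof -
  obtain m where m: "\<And>i. a $ i \<le> a $ m"
    using ex_maximal_index[of "($) a"] by blast
  note ex = inscribed_exists_acute[OF pos m] inscribed_exists_right[OF pos m]
    inscribed_exists_obtuse[OF pos m poly]
  consider "(\<Sum>i\<in>UNIV. arcsin (a $ i / a $ m)) < pi" | "(\<Sum>i\<in>UNIV. arcsin (a $ i / a $ m)) = pi"
    | "(\<Sum>i\<in>UNIV. arcsin (a $ i / a $ m)) > pi"
    by linarith
  then show ?thesis
    by cases (blast dest: ex)+
qed

text \<open>The three existence lemmas cover all values of the arcsine sum, and by uniqueness each
  produces the given polygon. Exclusive conclusions turn these implications into
  equivalences.\<close>

lemma inscribed_max_angle:
  fixes a :: "real ^ 'n::finite"
  assumes n: "CARD('n) \<ge> 3" and t: "inscribed a R t"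
    and m: "\<And>i. a $ i \<le> a $ m" and poly: "a $ m < (\<Sum>j\<in>UNIV - {m}. a $ j)"
  shows "t m < pi / 2 \<longleftrightarrow> (\<Sum>i\<in>UNIV. arcsin (a $ i / a $ m)) > pi"
    and "t m = pi / 2 \<longleftrightarrow> (\<Sum>i\<in>UNIV. arcsin (a $ i / a $ m)) = pi"
proof -
  define F where "F = (\<Sum>i\<in>UNIV. arcsin (a $ i / a $ m))"
  note pos = inscribedD(7)[OF t]
  note uniq = inscribed_unique[OF n t]
  have "t m < pi / 2" if "F > pi"
    using inscribed_exists_acute[OF pos m] that uniq unfolding F_def by auto
  moreover have "t m = pi / 2" if "F = pi"
    using inscribed_exists_right[OF pos m] that uniq unfolding F_def by auto
  moreover have "t m > pi / 2" if "F < pi"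
    using inscribed_exists_obtuse[OF pos m poly] that uniq unfolding F_def by auto
  ultimately show "t m < pi / 2 \<longleftrightarrow> (\<Sum>i\<in>UNIV. arcsin (a $ i / a $ m)) > pi"
    and "t m = pi / 2 \<longleftrightarrow> (\<Sum>i\<in>UNIV. arcsin (a $ i / a $ m)) = pi"
    unfolding F_def[symmetric] by linarith+
qed

section \<open>Differentiability of radius and angles\<close>

lemma has_derivative_vec_nth_iff:
  fixes f :: "'a::real_normed_vector \<Rightarrow> real ^ 'n::finite"
  shows "(f has_derivative f') (at x) \<longleftrightarrow> (\<forall>i. ((\<lambda>x. f x $ i) has_derivative (\<lambda>h. f' h $ i)) (at x))"
  by (subst has_derivative_componentwise_within) (auto simp: Basis_vec_def inner_axis)

section \<open>Radius and angles as functions of the sides\<close>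

definition circ_radius :: "real ^ 'n::finite \<Rightarrow> real" where
  "circ_radius a = (SOME R. \<exists>t. inscribed a R t)"

definition circ_angle :: "real ^ 'n::finite \<Rightarrow> 'n \<Rightarrow> real" where
  "circ_angle a = (SOME t. \<exists>R. inscribed a R t)"

lemma inscribed_circ:
  fixes a :: "real ^ 'n::finite"
  assumes "CARD('n) \<ge> 3" "inscribed a R t"
  shows "circ_radius a = R" "circ_angle a = t"
proof -
  have "\<exists>t. inscribed a (circ_radius a) t"
    unfolding circ_radius_def by (rule someI[of _ R]) (use assms(2) in blast)
  then show "circ_radius a = R"
    using inscribed_unique[OF assms] by blast
  have "\<exists>R. inscribed a R (circ_angle a)"
    unfolding circ_angle_def by (rule someI[of _ t]) (use assms(2) in blast)
  then show "circ_angle a = t"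
    using inscribed_unique[OF assms] by blast
qed

text \<open>
  The side vector as a function of the radius and of all half angles but the one at \<open>m\<close>;
  the entry \<open>m\<close> of the parameter vector holds the radius. Unlike the equation for the
  radius in terms of the sides, this map is smooth everywhere, and it has a left inverse by
  uniqueness, so the inverse function theorem applies.
\<close>

definition free_angle :: "'n::finite \<Rightarrow> real ^ 'n \<Rightarrow> 'n \<Rightarrow> real" where
  "free_angle m p i = (if i = m then pi - (\<Sum>j\<in>UNIV - {m}. p $ j) else p $ i)"

definition free_sides :: "'n::finite \<Rightarrow> real ^ 'n \<Rightarrow> real ^ 'n" where
  "free_sides m p = (\<chi> i. p $ m * sin (free_angle m p i))"

lemma continuous_on_free_angle [continuous_intros]: "continuous_on S (\<lambda>p. free_angle m p i)"
  unfolding free_angle_def by (cases "i = m") (auto intro!: continuous_intros)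

lemma continuous_on_free_sides: "continuous_on S (free_sides m)"
  unfolding free_sides_def by (auto intro!: continuous_intros)

lemma has_derivative_free_angle [derivative_intros]:
  "((\<lambda>p. free_angle m p i) has_derivative
     (\<lambda>h. if i = m then - (\<Sum>j\<in>UNIV - {m}. h $ j) else h $ i)) (at p)"
  unfolding free_angle_def
  by (cases "i = m") (auto intro!: derivative_eq_intros bounded_linear.has_derivative[OF bounded_linear_vec_nth])

lemma has_derivative_free_sides:
  "(free_sides m has_derivative
     (\<lambda>h. \<chi> i. h $ m * sin (free_angle m p i) + p $ m * (cos (free_angle m p i)
        * (if i = m then - (\<Sum>j\<in>UNIV - {m}. h $ j) else h $ i)))) (at p)"
  unfolding has_derivative_vec_nth_iff free_sides_def
  by (auto intro!: derivative_eq_intros bounded_linear.has_derivative[OF bounded_linear_vec_nth])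

lemma inscribed_free_sides:
  assumes "0 < p $ m" "\<And>i. 0 < free_angle m p i" "\<And>i. free_angle m p i < pi"
  shows "inscribed (free_sides m p) (p $ m) (free_angle m p)"
proof -
  have "sum (free_angle m p) (UNIV - {m}) = (\<Sum>j\<in>UNIV - {m}. p $ j)"
    by (rule sum.cong) (auto simp: free_angle_def)
  then have "sum (free_angle m p) UNIV = pi"
    using sum.remove[of UNIV m "free_angle m p"] by (simp add: free_angle_def)
  then show ?thesis
    using assms by (auto simp: inscribed_def free_sides_def)
qed

text \<open>Differentiating \<open>a $ j = R * sin (t j)\<close> yields \<open>t'\<close> at the
  acute angles, and the constancy of the total then yields \<open>R'\<close>. The angle at
  \<open>m\<close> gets no such formula because \<open>cos (t m)\<close> may vanish; it is
  determined by the others.\<close>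

lemma has_derivative_circ:
  fixes a :: "real ^ 'n::finite"
  assumes n: "CARD('n) \<ge> 3" and t: "inscribed a R t" and acute: "\<And>j. j \<noteq> m \<Longrightarrow> t j < pi / 2"
  defines "R' \<equiv> \<lambda>h. (h $ m + cos (t m) * (\<Sum>j\<in>UNIV - {m}. h $ j / cos (t j)))
                  / (sin (t m) + cos (t m) * (\<Sum>j\<in>UNIV - {m}. tan (t j)))"
  defines "t' \<equiv> \<lambda>i h. (h $ i - R' h * sin (t i)) / (R * cos (t i))"
  shows "(circ_radius has_derivative R') (at a)"
    and "j \<noteq> m \<Longrightarrow> ((\<lambda>a. circ_angle a j) has_derivative t' j) (at a)"
proof -
  define p where "p = (\<chi> i. if i = m then R else t i)"
  define g where "g a = (\<chi> i. if i = m then circ_radius a else circ_angle a i)" for a :: "real ^ 'n"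
  define f' where "f' h = (\<chi> i. h $ m * sin (free_angle m p i) + p $ m * (cos (free_angle m p i)
        * (if i = m then - (\<Sum>j\<in>UNIV - {m}. h $ j) else h $ i)))" for h :: "real ^ 'n"
  define g' where "g' h = (\<chi> i. if i = m then R' h else t' i h)" for h :: "real ^ 'n"
  \<comment> \<open>The open set of parameters that describe an inscribed polygon; uniqueness makes
    \<open>g\<close> a left inverse of \<open>free_sides m\<close> there.\<close>
  define S where "S = {p. 0 < p $ m} \<inter> (\<Inter>i. {p. 0 < free_angle m p i} \<inter> {p. free_angle m p i < pi})"
  note tD = inscribedD[OF t]
  have "sum (($) p) (UNIV - {m}) = sum t (UNIV - {m})"
    by (rule sum.cong) (auto simp: p_def)
  then have ang: "free_angle m p = t"
    using tD(8)[of m] by (auto simp: free_angle_def p_def)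
  have pm: "p $ m = R"
    by (simp add: p_def)
  have fp: "free_sides m p = a"
    using tD(5) by (simp add: free_sides_def ang pm vec_eq_iff)
  have "open S"
    unfolding S_def by (intro open_Int open_INT ballI open_Collect_less continuous_intros) auto
  moreover have "p \<in> S"
    using tD(1-3) by (auto simp: S_def ang pm)
  moreover have "g (free_sides m q) = q" if "q \<in> S" for q
  proof -
    have "inscribed (free_sides m q) (q $ m) (free_angle m q)"
      using that by (intro inscribed_free_sides) (auto simp: S_def)
    then show ?thesis
      using inscribed_circ[OF n] by (auto simp: g_def free_angle_def vec_eq_iff)
  qed
  moreover have "(free_sides m has_derivative f') (at p)"
    unfolding f'_def by (rule has_derivative_free_sides)
  \<comment> \<open>Checked row by row: off \<open>m\<close> this is the formula for
    \<open>t'\<close>, and row \<open>m\<close> is the definition of \<open>R'\<close> with its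
    positive denominator \<open>E\<close> cleared.\<close>
  moreover have "f' \<circ> g' = id"
  proof (rule ext, simp add: vec_eq_iff, intro allI)
    fix h :: "real ^ 'n" and i
    define E where "E = sin (t m) + cos (t m) * (\<Sum>j\<in>UNIV - {m}. tan (t j))"
    have E: "E > 0"
      unfolding E_def by (rule inscribed_denominator_pos[OF n t acute])
    have c: "cos (t j) > 0" if "j \<noteq> m" for j
      using tD(2)[of j] acute[OF that] by (intro cos_gt_zero)
    show "f' (g' h) $ i = h $ i"
    proof (cases "i = m")
      case False
      then show ?thesis
        using c[OF False] tD(1) by (simp add: f'_def g'_def ang pm t'_def)
    next
      case True
      have "(\<Sum>j\<in>UNIV - {m}. g' h $ j) = (\<Sum>j\<in>UNIV - {m}. (h $ j / cos (t j) - R' h * tan (t j)) / R)"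
      proof (rule sum.cong)
        fix j assume "j \<in> UNIV - {m}"
        then show "g' h $ j = (h $ j / cos (t j) - R' h * tan (t j)) / R"
          using c[of j] tD(1) unfolding g'_def t'_def tan_def
          by (simp add: diff_divide_distrib mult.commute)
      qed simp
      also have "\<dots> = ((\<Sum>j\<in>UNIV - {m}. h $ j / cos (t j)) - R' h * (\<Sum>j\<in>UNIV - {m}. tan (t j))) / R"
        by (simp add: sum_subtractf sum_distrib_left flip: sum_divide_distrib)
      finally have "f' (g' h) $ m = R' h * sin (t m)
          - cos (t m) * ((\<Sum>j\<in>UNIV - {m}. h $ j / cos (t j)) - R' h * (\<Sum>j\<in>UNIV - {m}. tan (t j)))"
        using tD(1) by (simp add: f'_def ang pm) (simp add: g'_def)
      also have "\<dots> = R' h * E - cos (t m) * (\<Sum>j\<in>UNIV - {m}. h $ j / cos (t j))"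
        by (simp add: E_def algebra_simps)
      also have "\<dots> = h $ m"
        using E unfolding R'_def E_def[symmetric] by simp
      finally show ?thesis using True by simp
    qed
  qed
  ultimately have "(g has_derivative g') (at a)"
    using has_derivative_inverse_strong[of S p "free_sides m" g f' g'] continuous_on_free_sides fp
    by auto
  then have g': "((\<lambda>x. g x $ i) has_derivative (\<lambda>h. g' h $ i)) (at a)" for i
    by (simp add: has_derivative_vec_nth_iff)
  show "(circ_radius has_derivative R') (at a)"
    using g'[of m] by (simp add: g_def g'_def)
  show "((\<lambda>a. circ_angle a j) has_derivative t' j) (at a)" if "j \<noteq> m" for j
    using g'[of j] that by (simp add: g_def g'_def)
qed

section \<open>Smooth functions generated by a family closed under differentiation\<close>

text \<open>If the derivatives of the generators in \<open>B\<close> are again expressions of this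
  kind, then so are those of all members, and smoothness follows without computing higher
  derivatives. Only values on \<open>S\<close> count in \<open>inverse\<close> and
  \<open>cong\<close>, which is harmless since derivatives on an open \<open>S\<close> depend on
  nothing else.\<close>

inductive_set smooth_closure ::
    "'a::real_normed_vector set \<Rightarrow> ('a \<Rightarrow> real) set \<Rightarrow> ('a \<Rightarrow> real) set" for S B where
  gen: "f \<in> B \<Longrightarrow> f \<in> smooth_closure S B"
| const: "(\<lambda>x. c) \<in> smooth_closure S B"
| add: "f \<in> smooth_closure S B \<Longrightarrow> g \<in> smooth_closure S B \<Longrightarrow> (\<lambda>x. f x + g x) \<in> smooth_closure S B"
| mult: "f \<in> smooth_closure S B \<Longrightarrow> g \<in> smooth_closure S B \<Longrightarrow> (\<lambda>x. f x * g x) \<in> smooth_closure S B"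
| inverse: "f \<in> smooth_closure S B \<Longrightarrow> (\<And>x. x \<in> S \<Longrightarrow> f x \<noteq> 0)
    \<Longrightarrow> (\<lambda>x. inverse (f x)) \<in> smooth_closure S B"
| sin: "f \<in> smooth_closure S B \<Longrightarrow> (\<lambda>x. sin (f x)) \<in> smooth_closure S B"
| cos: "f \<in> smooth_closure S B \<Longrightarrow> (\<lambda>x. cos (f x)) \<in> smooth_closure S B"
| sinh: "f \<in> smooth_closure S B \<Longrightarrow> (\<lambda>x. sinh (f x)) \<in> smooth_closure S B"
| cosh: "f \<in> smooth_closure S B \<Longrightarrow> (\<lambda>x. cosh (f x)) \<in> smooth_closure S B"
| cong: "f \<in> smooth_closure S B \<Longrightarrow> (\<And>x. x \<in> S \<Longrightarrow> g x = f x) \<Longrightarrow> g \<in> smooth_closure S B"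

lemma smooth_closure_minus:
  "f \<in> smooth_closure S B \<Longrightarrow> (\<lambda>x. - f x) \<in> smooth_closure S B"
  by (rule smooth_closure.cong[OF smooth_closure.mult[OF smooth_closure.const[of "-1"]]]) auto

lemma smooth_closure_diff:
  "f \<in> smooth_closure S B \<Longrightarrow> g \<in> smooth_closure S B \<Longrightarrow> (\<lambda>x. f x - g x) \<in> smooth_closure S B"
  using smooth_closure.add[OF _ smooth_closure_minus, of f S B g] by simp

lemma smooth_closure_divide:
  "f \<in> smooth_closure S B \<Longrightarrow> g \<in> smooth_closure S B \<Longrightarrow> (\<And>x. x \<in> S \<Longrightarrow> g x \<noteq> 0)
    \<Longrightarrow> (\<lambda>x. f x / g x) \<in> smooth_closure S B"
  using smooth_closure.mult[OF _ smooth_closure.inverse, of f S B g] by (simp add: divide_inverse)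

lemma smooth_closure_sum:
  "(\<And>i. i \<in> I \<Longrightarrow> f i \<in> smooth_closure S B) \<Longrightarrow> (\<lambda>x. \<Sum>i\<in>I. f i x) \<in> smooth_closure S B"
  by (induction I rule: infinite_finite_induct) (auto intro: smooth_closure.intros)

lemmas smooth_closure_rules = smooth_closure.const smooth_closure.add smooth_closure.mult
  smooth_closure.sin smooth_closure.cos smooth_closure.sinh smooth_closure.cosh
  smooth_closure_diff smooth_closure_divide smooth_closure_sum

lemma has_derivative_sinh_cosh_real:
  fixes f :: "'a::real_normed_vector \<Rightarrow> real"
  assumes "(f has_derivative f') (at x)"
  shows "((\<lambda>x. sinh (f x)) has_derivative (\<lambda>h. f' h * cosh (f x))) (at x)"
    and "((\<lambda>x. cosh (f x)) has_derivative (\<lambda>h. f' h * sinh (f x))) (at x)"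
proof -
  have "(sinh has_real_derivative cosh (f x)) (at (f x))" "(cosh has_real_derivative sinh (f x)) (at (f x))"
    by (auto intro!: derivative_eq_intros)
  note this[unfolded has_field_derivative_def, THEN has_derivative_compose[OF assms]]
  then show "((\<lambda>x. sinh (f x)) has_derivative (\<lambda>h. f' h * cosh (f x))) (at x)"
    and "((\<lambda>x. cosh (f x)) has_derivative (\<lambda>h. f' h * sinh (f x))) (at x)"
    by (simp_all add: mult.commute)
qed

lemma smooth_closure_has_derivative:
  assumes "open S"
    and B: "\<And>f. f \<in> B \<Longrightarrow> \<exists>D. (\<forall>x\<in>S. (f has_derivative D x) (at x))
              \<and> (\<forall>v. (\<lambda>x. D x v) \<in> smooth_closure S B)"
    and "f \<in> smooth_closure S B"
  shows "\<exists>D. (\<forall>x\<in>S. (f has_derivative D x) (at x)) \<and> (\<forall>v. (\<lambda>x. D x v) \<in> smooth_closure S B)"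
  using assms(3)
proof induction
  case (gen f)
  then show ?case by (rule B)
next
  case (const c)
  show ?case
    by (rule exI[of _ "\<lambda>x v. 0"]) (auto intro: smooth_closure.const)
next
  case (add f g)
  then obtain D E where "\<forall>x\<in>S. (f has_derivative D x) (at x)" "\<forall>v. (\<lambda>x. D x v) \<in> smooth_closure S B"
    "\<forall>x\<in>S. (g has_derivative E x) (at x)" "\<forall>v. (\<lambda>x. E x v) \<in> smooth_closure S B"
    by blast
  then show ?case
    by (intro exI[of _ "\<lambda>x v. D x v + E x v"]) (auto intro: smooth_closure.add has_derivative_add)
next
  case (mult f g)
  then obtain D E where "\<forall>x\<in>S. (f has_derivative D x) (at x)" "\<forall>v. (\<lambda>x. D x v) \<in> smooth_closure S B"
    "\<forall>x\<in>S. (g has_derivative E x) (at x)" "\<forall>v. (\<lambda>x. E x v) \<in> smooth_closure S B"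
    by blast
  then show ?case
    using mult.hyps
    by (intro exI[of _ "\<lambda>x v. f x * E x v + D x v * g x"])
      (auto intro!: smooth_closure.add smooth_closure.mult has_derivative_mult)
next
  case (inverse f)
  then obtain D where "\<forall>x\<in>S. (f has_derivative D x) (at x)" "\<forall>v. (\<lambda>x. D x v) \<in> smooth_closure S B"
    by blast
  then show ?case
    using inverse.hyps
    by (intro exI[of _ "\<lambda>x v. - (inverse (f x) * D x v * inverse (f x))"])
      (auto intro!: smooth_closure.mult smooth_closure_minus smooth_closure.inverse has_derivative_inverse)
next
  case (sin f)
  then obtain D where "\<forall>x\<in>S. (f has_derivative D x) (at x)" "\<forall>v. (\<lambda>x. D x v) \<in> smooth_closure S B"
    by blast
  then show ?case
    using sin.hyps
    by (intro exI[of _ "\<lambda>x v. D x v * cos (f x)"])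
      (auto intro!: smooth_closure.mult smooth_closure.cos has_derivative_sin)
next
  case (cos f)
  then obtain D where "\<forall>x\<in>S. (f has_derivative D x) (at x)" "\<forall>v. (\<lambda>x. D x v) \<in> smooth_closure S B"
    by blast
  then show ?case
    using cos.hyps
    by (intro exI[of _ "\<lambda>x v. - (D x v * sin (f x))"])
      (auto intro!: smooth_closure.mult smooth_closure.sin smooth_closure_minus
        has_derivative_eq_rhs[OF has_derivative_cos])
next
  case (sinh f)
  then obtain D where "\<forall>x\<in>S. (f has_derivative D x) (at x)" "\<forall>v. (\<lambda>x. D x v) \<in> smooth_closure S B"
    by blast
  then show ?case
    using sinh.hyps
    by (intro exI[of _ "\<lambda>x v. D x v * cosh (f x)"])
      (auto intro!: smooth_closure.mult smooth_closure.cosh has_derivative_sinh_cosh_real(1))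
next
  case (cosh f)
  then obtain D where "\<forall>x\<in>S. (f has_derivative D x) (at x)" "\<forall>v. (\<lambda>x. D x v) \<in> smooth_closure S B"
    by blast
  then show ?case
    using cosh.hyps
    by (intro exI[of _ "\<lambda>x v. D x v * sinh (f x)"])
      (auto intro!: smooth_closure.mult smooth_closure.sinh has_derivative_sinh_cosh_real(2))
next
  case (cong f g)
  then obtain D where D: "\<forall>x\<in>S. (f has_derivative D x) (at x)" "\<forall>v. (\<lambda>x. D x v) \<in> smooth_closure S B"
    by blast
  have "(g has_derivative D x) (at x)" if "x \<in> S" for x
    by (rule has_derivative_transform_within_open[OF _ \<open>open S\<close> that]) (use D cong.hyps that in auto)
  then show ?case
    using D by blast
qed

lemma smooth_closure_Ck_on:
  assumes "open S"
    and B: "\<And>f. f \<in> B \<Longrightarrow> \<exists>D. (\<forall>x\<in>S. (f has_derivative D x) (at x))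
              \<and> (\<forall>v. (\<lambda>x. D x v) \<in> smooth_closure S B)"
    and "f \<in> smooth_closure S B"
  shows "Ck_on k S f"
  using assms(3)
proof (induction k arbitrary: f)
  case (0 f)
  obtain D where "\<forall>x\<in>S. (f has_derivative D x) (at x)"
    using smooth_closure_has_derivative[OF assms(1) B 0] by blast
  then show ?case
    by (auto intro!: continuous_at_imp_continuous_on has_derivative_continuous)
next
  case (Suc k f)
  obtain D where D: "\<forall>x\<in>S. (f has_derivative D x) (at x)" "\<forall>v. (\<lambda>x. D x v) \<in> smooth_closure S B"
    using smooth_closure_has_derivative[OF assms(1) B Suc.prems] by blast
  \<comment> \<open>\<open>D\<close> is known to be the derivative only on \<open>S\<close>, so the
    passage from one to the other goes through \<open>cong\<close>.\<close>
  have "(\<lambda>x. frechet_derivative f (at x) v) \<in> smooth_closure S B" for v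
    by (rule smooth_closure.cong[of "\<lambda>x. D x v"]) (use D in \<open>auto simp flip: frechet_derivative_at\<close>)
  then show ?case
    using D(1) Suc.IH by (auto simp: differentiable_def)
qed

text \<open>Differentiability is a pointwise condition, and continuity on open sets is
  local.\<close>

lemma Ck_on_UN:
  assumes "\<And>i. i \<in> I \<Longrightarrow> open (S i)" "\<And>i. i \<in> I \<Longrightarrow> Ck_on k (S i) f"
  shows "Ck_on k (\<Union>i\<in>I. S i) f"
  using assms(2) by (induction k arbitrary: f) (auto intro!: continuous_on_open_UN assms(1))

section \<open>Smoothness of the circumradius\<close>

definition half_sinh :: "real ^ 'n::finite \<Rightarrow> real ^ 'n" where
  "half_sinh d = (\<chi> i. sinh (d $ i / 2))"

abbreviation radius :: "real ^ 'n::finite \<Rightarrow> real" where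
  "radius d \<equiv> arsinh (circ_radius (half_sinh d))"

abbreviation angle :: "real ^ 'n::finite \<Rightarrow> 'n \<Rightarrow> real" where
  "angle d \<equiv> circ_angle (half_sinh d)"

text \<open>The denominator \<open>E\<close> of \<open>R'\<close>, with \<open>m\<close> as the
  index singled out.\<close>

definition denom :: "'n::finite \<Rightarrow> real ^ 'n \<Rightarrow> real" where
  "denom m d = sin (angle d m) + cos (angle d m) * (\<Sum>j\<in>UNIV - {m}. tan (angle d j))"

lemma open_AC: "open (AC :: (real ^ 'n::finite) set)"
proof -
  have "(AC :: (real ^ 'n) set) = (\<Inter>i. {d. 0 < d $ i})
      \<inter> (\<Inter>i. {d. sinh (d $ i / 2) < (\<Sum>j\<in>UNIV - {i}. sinh (d $ j / 2))})"
    by (auto simp: AC_def)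
  also have "open \<dots>"
    by (intro open_Int open_INT ballI open_Collect_less continuous_intros) auto
  finally show ?thesis .
qed

lemma half_sinh_inscribed:
  fixes d :: "real ^ 'n::finite"
  assumes "CARD('n) \<ge> 3" "d \<in> AC"
  shows "inscribed (half_sinh d) (sinh (radius d)) (angle d)"
proof -
  have "\<exists>R t. inscribed (half_sinh d) R t"
    using assms(2) by (intro inscribed_exists) (auto simp: AC_def half_sinh_def)
  then show ?thesis
    using inscribed_circ[OF assms(1)] by fastforce
qed

lemma has_derivative_half_sinh:
  "(half_sinh has_derivative (\<lambda>h. \<chi> i. cosh (d $ i / 2) / 2 * h $ i)) (at d)"
proof -
  have "((\<lambda>d. d $ i / 2) has_derivative (\<lambda>h. h $ i / 2)) (at d)" for i
    by (intro bounded_linear_imp_has_derivative bounded_linear_divide[THEN bounded_linear_compose]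
        bounded_linear_vec_nth)
  from has_derivative_sinh_cosh_real(1)[OF this] show ?thesis
    unfolding has_derivative_vec_nth_iff half_sinh_def by (simp add: mult.commute)
qed

text \<open>Chain rule through \<open>half_sinh\<close> and \<open>arsinh\<close>. Only coordinates,
  the radius and the angles occur in the formulas, as the closure argument for smoothness
  demands.\<close>

lemma has_derivative_radius_angle:
  fixes d :: "real ^ 'n::finite"
  assumes n: "CARD('n) \<ge> 3" and d: "d \<in> AC" and acute: "\<And>j. j \<noteq> m \<Longrightarrow> angle d j < pi / 2"
  defines "r' \<equiv> \<lambda>h. (cosh (d $ m / 2) / 2 * h $ m + cos (angle d m)
      * (\<Sum>j\<in>UNIV - {m}. cosh (d $ j / 2) / 2 * h $ j / cos (angle d j))) / denom m d"
  shows "(radius has_derivative (\<lambda>h. r' h / cosh (radius d))) (at d)"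
    and "j \<noteq> m \<Longrightarrow> ((\<lambda>d. angle d j) has_derivative (\<lambda>h. (cosh (d $ j / 2) / 2 * h $ j
      - r' h * sin (angle d j)) / (sinh (radius d) * cos (angle d j)))) (at d)"
proof -
  note circ = has_derivative_circ[OF n half_sinh_inscribed[OF n d] acute]
  have cosh: "cosh (radius d) = sqrt ((circ_radius (half_sinh d))\<^sup>2 + 1)"
    by (simp add: cosh_arsinh_real)
  have "(arsinh has_derivative (\<lambda>h. h * (1 / cosh (radius d)))) (at (circ_radius (half_sinh d)))"
    using arsinh_real_has_field_derivative[of "circ_radius (half_sinh d)" UNIV]
    unfolding cosh mult_commute_abs has_field_derivative_def by simp
  from has_derivative_compose[OF has_derivative_compose[OF has_derivative_half_sinh circ(1)] this]
  show "(radius has_derivative (\<lambda>h. r' h / cosh (radius d))) (at d)"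
    by (simp add: r'_def denom_def)
  show "((\<lambda>d. angle d j) has_derivative (\<lambda>h. (cosh (d $ j / 2) / 2 * h $ j
      - r' h * sin (angle d j)) / (sinh (radius d) * cos (angle d j)))) (at d)" if "j \<noteq> m"
    using has_derivative_compose[OF has_derivative_half_sinh circ(2)[OF _ that]]
    by (simp add: r'_def denom_def)
qed

section \<open>Partial derivatives of the circumradius\<close>

lemma partial_deriv_eq:
  assumes "(f has_derivative f') (at d)"
  shows "partial_deriv i f d = f' (axis i 1)"
proof -
  have "((\<lambda>t. d + t *\<^sub>R axis i 1) has_derivative (\<lambda>t. t *\<^sub>R axis i 1)) (at 0)"
    by (auto intro!: derivative_eq_intros)
  from has_derivative_compose[OF this, of f f'] assms
  have "((\<lambda>t. f (d + t *\<^sub>R axis i 1)) has_derivative (\<lambda>t. f' (t *\<^sub>R axis i 1))) (at 0)"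
    by simp
  then have "((\<lambda>t. f (d + t *\<^sub>R axis i 1)) has_real_derivative f' (axis i 1)) (at 0)"
    using linear_cmul[OF has_derivative_linear[OF assms]]
    by (simp add: has_field_derivative_def mult_commute_abs)
  then show ?thesis
    unfolding partial_deriv_def by (rule DERIV_imp_deriv)
qed

text \<open>Agreement with \<open>radius\<close> on the open set \<open>AC\<close> suffices, so
  \<open>J e\<close> can take the place of \<open>f\<close>. Any \<open>m\<close> with all other
  angles acute is admissible; when all angles are acute, every index can be
  \<open>m\<close>.\<close>

lemma partial_deriv_radius:
  fixes d :: "real ^ 'n::finite"
  assumes n: "CARD('n) \<ge> 3" and f: "\<And>d. d \<in> AC \<Longrightarrow> f d = radius d"
    and d: "d \<in> AC" and acute: "\<And>j. j \<noteq> m \<Longrightarrow> angle d j < pi / 2"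
  shows "partial_deriv m f d = cosh (d $ m / 2) / cosh (radius d) / (2 * denom m d)"
    and "i \<noteq> m \<Longrightarrow> partial_deriv i f d
      = cos (angle d m) * (cosh (d $ i / 2) / cos (angle d i)) / (2 * denom m d * cosh (radius d))"
proof -
  have "(f has_derivative (\<lambda>h. (cosh (d $ m / 2) / 2 * h $ m + cos (angle d m)
      * (\<Sum>j\<in>UNIV - {m}. cosh (d $ j / 2) / 2 * h $ j / cos (angle d j))) / denom m d / cosh (radius d)))
      (at d)"
    by (rule has_derivative_transform_within_open[OF has_derivative_radius_angle(1)[OF n d acute] open_AC d])
      (use f in auto)
  note pd = partial_deriv_eq[OF this]
  have axis0: "axis i 1 $ k = (if k = i then 1 else (0::real))" for i k :: 'n
    by (simp add: axis_def)
  have "(\<Sum>j\<in>UNIV - {m}. cosh (d $ j / 2) / 2 * axis m 1 $ j / cos (angle d j)) = 0"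
    by (rule sum.neutral) (simp add: axis0)
  then show "partial_deriv m f d = cosh (d $ m / 2) / cosh (radius d) / (2 * denom m d)"
    by (simp add: pd axis0)
  assume "i \<noteq> m"
  have "(\<Sum>j\<in>UNIV - {m}. cosh (d $ j / 2) / 2 * axis i 1 $ j / cos (angle d j))
      = (\<Sum>j\<in>UNIV - {m}. if j = i then cosh (d $ i / 2) / 2 / cos (angle d i) else 0)"
    by (rule sum.cong) (simp_all add: axis0)
  also have "\<dots> = cosh (d $ i / 2) / 2 / cos (angle d i)"
    using \<open>i \<noteq> m\<close> by (subst sum.delta) auto
  finally show "partial_deriv i f d
      = cos (angle d m) * (cosh (d $ i / 2) / cos (angle d i)) / (2 * denom m d * cosh (radius d))"
    using \<open>i \<noteq> m\<close> by (simp add: pd axis0)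
qed

text \<open>The region where the derivative formulas relative to \<open>m\<close> are valid: they
  divide by \<open>cos (angle d j)\<close> for \<open>j \<noteq> m\<close>. An index of a longest
  side always gives a chart around the point.\<close>

definition AC_chart :: "'n::finite \<Rightarrow> (real ^ 'n) set" where
  "AC_chart m = {d \<in> AC. \<forall>j. j \<noteq> m \<longrightarrow> angle d j < pi / 2}"

lemma AC_eq_UN_chart:
  assumes n: "CARD('n::finite) \<ge> 3"
  shows "(AC :: (real ^ 'n) set) = (\<Union>m. AC_chart m)"
proof (intro equalityI subsetI)
  fix d :: "real ^ 'n" assume d: "d \<in> AC"
  obtain m where "\<And>i. half_sinh d $ i \<le> half_sinh d $ m"
    using ex_maximal_index[of "($) (half_sinh d)"] by blast
  then show "d \<in> (\<Union>m. AC_chart m)"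
    using inscribed_max_acute[OF n half_sinh_inscribed[OF n d]] d by (auto simp: AC_chart_def)
qed (auto simp: AC_chart_def)

text \<open>The angles off \<open>m\<close> are differentiable at points of the chart, hence
  continuous there, and finitely many strict bounds persist nearby.\<close>

lemma open_AC_chart:
  assumes n: "CARD('n::finite) \<ge> 3"
  shows "open (AC_chart m :: (real ^ 'n) set)"
proof (subst open_subopen, intro ballI)
  fix d :: "real ^ 'n" assume "d \<in> AC_chart m"
  then have d: "d \<in> AC" "\<And>j. j \<noteq> m \<Longrightarrow> angle d j < pi / 2"
    by (auto simp: AC_chart_def)
  have ev: "\<forall>\<^sub>F x in nhds d. angle x j < pi / 2" if "j \<noteq> m" for j
  proof -
    have "continuous (at d) (\<lambda>x. angle x j)"
      using has_derivative_radius_angle(2)[OF n d that] by (rule has_derivative_continuous)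
    then show ?thesis
      using order_tendstoD(2)[of _ _ _ "pi / 2"] d(2)[OF that]
      by (simp add: eventually_nhds_conv_at continuous_at)
  qed
  have "\<forall>\<^sub>F x in nhds d. \<forall>j. j \<noteq> m \<longrightarrow> angle x j < pi / 2"
    by (rule eventually_all_finite) (use ev in auto)
  moreover have "\<forall>\<^sub>F x in nhds d. x \<in> AC"
    using open_AC d(1) by (rule eventually_nhds_in_open)
  ultimately have "\<forall>\<^sub>F x in nhds d. x \<in> AC_chart m"
    by eventually_elim (simp add: AC_chart_def)
  then show "\<exists>T. open T \<and> d \<in> T \<and> T \<subseteq> AC_chart m"
    by (auto simp: eventually_nhds)
qed

lemma smooth_on_AC:
  fixes f :: "real ^ 'n::finite \<Rightarrow> real"
  assumes n: "CARD('n) \<ge> 3" and f: "\<And>d. d \<in> AC \<Longrightarrow> f d = radius d"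
  shows "smooth_on AC f"
proof -
  have "Ck_on k (AC_chart m) f" for k and m :: 'n
  proof -
    \<comment> \<open>The angle at \<open>m\<close> is not a generator, since its cosine may vanish
      on the chart; it enters below as \<pi> minus the other angles.\<close>
    let ?B = "insert radius ((\<lambda>j d. angle d j) ` (UNIV - {m}) \<union> range (\<lambda>i d. d $ i))"
    let ?A = "smooth_closure (AC_chart m) ?B"
    have coord: "(\<lambda>d. d $ i) \<in> ?A" for i
      by (rule smooth_closure.gen) auto
    have radius: "radius \<in> ?A"
      by (rule smooth_closure.gen) auto
    have angle: "(\<lambda>d. angle d j) \<in> ?A" if "j \<noteq> m" for j
      by (rule smooth_closure.gen) (use that in auto)
    have chartD: "d \<in> AC" "\<And>j. j \<noteq> m \<Longrightarrow> angle d j < pi / 2"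
        "inscribed (half_sinh d) (sinh (radius d)) (angle d)" if "d \<in> AC_chart m" for d
      using that half_sinh_inscribed[OF n] by (auto simp: AC_chart_def)
    have angle_m: "(\<lambda>d. angle d m) \<in> ?A"
    proof (rule smooth_closure.cong)
      show "(\<lambda>d. pi - (\<Sum>j\<in>UNIV - {m}. angle d j)) \<in> ?A"
        by (intro smooth_closure_diff smooth_closure.const smooth_closure_sum angle) auto
      show "angle d m = pi - (\<Sum>j\<in>UNIV - {m}. angle d j)" if "d \<in> AC_chart m" for d
        using inscribedD(8)[OF chartD(3)[OF that], of m] by simp
    qed
    have angle: "(\<lambda>d. angle d j) \<in> ?A" for j
      using angle angle_m by (cases "j = m") auto
    have cos: "cos (angle d j) \<noteq> 0" if "d \<in> AC_chart m" "j \<noteq> m" for d j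
      using cos_gt_zero[OF inscribedD(2)[OF chartD(3)[OF that(1)]] chartD(2)[OF that]] by simp
    have denom: "denom m \<in> ?A" "\<And>d. d \<in> AC_chart m \<Longrightarrow> denom m d \<noteq> 0"
    proof -
      show "denom m \<in> ?A"
        unfolding denom_def tan_def using cos
        by (intro smooth_closure_rules angle) auto
      show "denom m d \<noteq> 0" if "d \<in> AC_chart m" for d
        using inscribed_denominator_pos[OF n chartD(3)[OF that] chartD(2)[OF that], of m]
        by (simp add: denom_def)
    qed
    define r' where "r' d h = (cosh (d $ m / 2) / 2 * h $ m + cos (angle d m)
      * (\<Sum>j\<in>UNIV - {m}. cosh (d $ j / 2) / 2 * h $ j / cos (angle d j))) / denom m d" for d h :: "real ^ 'n"
    have r': "(\<lambda>d. r' d h) \<in> ?A" for h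
      unfolding r'_def using cos denom(2)
      by (intro smooth_closure_rules denom(1) coord angle) auto
    show ?thesis
    proof (rule smooth_closure_Ck_on[OF open_AC_chart[OF n]])
      show "f \<in> ?A"
        by (rule smooth_closure.cong[OF radius]) (use f chartD(1) in auto)
      fix g assume "g \<in> ?B"
      then consider "g = radius" | j where "j \<noteq> m" "g = (\<lambda>d. angle d j)" | i where "g = (\<lambda>d. d $ i)"
        by blast
      then show "\<exists>D. (\<forall>x\<in>AC_chart m. (g has_derivative D x) (at x)) \<and> (\<forall>v. (\<lambda>x. D x v) \<in> ?A)"
      proof cases
        case 1
        show ?thesis
        proof (intro exI conjI ballI allI)
          show "(g has_derivative (\<lambda>h. r' d h / cosh (radius d))) (at d)" if "d \<in> AC_chart m" for d
            unfolding 1 r'_def by (rule has_derivative_radius_angle(1)[OF n chartD(1,2)[OF that]])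
          show "(\<lambda>d. r' d h / cosh (radius d)) \<in> ?A" for h
            by (intro smooth_closure_rules radius r') auto
        qed
      next
        case (2 j)
        show ?thesis
        proof (intro exI conjI ballI allI)
          show "(g has_derivative (\<lambda>h. (cosh (d $ j / 2) / 2 * h $ j
              - r' d h * sin (angle d j)) / (sinh (radius d) * cos (angle d j)))) (at d)"
            if "d \<in> AC_chart m" for d
            unfolding 2(2) r'_def
            by (rule has_derivative_radius_angle(2)[OF n chartD(1,2)[OF that] 2(1)])
          show "(\<lambda>d. (cosh (d $ j / 2) / 2 * h $ j
              - r' d h * sin (angle d j)) / (sinh (radius d) * cos (angle d j))) \<in> ?A" for h
          proof (intro smooth_closure_rules radius r' coord angle)
            show "sinh (radius d) * cos (angle d j) \<noteq> 0" if "d \<in> AC_chart m" for d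
              using inscribedD(1)[OF chartD(3)[OF that]] cos[OF that 2(1)] by auto
          qed auto
        qed
      next
        case (3 i)
        show ?thesis
        proof (intro exI conjI ballI allI)
          show "(g has_derivative (\<lambda>h. h $ i)) (at d)" for d
            unfolding 3 by (rule bounded_linear_imp_has_derivative[OF bounded_linear_vec_nth])
        qed (rule smooth_closure.const)
      qed
    qed
  qed
  then show ?thesis
    unfolding smooth_on_def AC_eq_UN_chart[OF n]
    by (intro allI Ck_on_UN open_AC_chart[OF n])
qed

section \<open>Cyclic polygons in the hyperbolic plane\<close>

text \<open>On the disc this is the square of \<open>sinh\<close> of half the distance, which avoids
  \<open>arcosh\<close> altogether.\<close>

definition hyp_quot :: "complex \<Rightarrow> complex \<Rightarrow> real" where
  "hyp_quot z w = (norm (z - w))\<^sup>2 / ((1 - (norm z)\<^sup>2) * (1 - (norm w)\<^sup>2))"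

lemma hyp_plane_norm: "z \<in> hyp_plane \<Longrightarrow> (norm z)\<^sup>2 < 1"
  by (simp add: hyp_plane_def abs_square_less_1)

lemma hyp_dist_eq_iff:
  assumes "z \<in> hyp_plane" "w \<in> hyp_plane" "0 \<le> d"
  shows "hyp_dist z w = d \<longleftrightarrow> hyp_quot z w = (sinh (d / 2))\<^sup>2"
proof -
  have q: "0 \<le> hyp_quot z w"
    using hyp_plane_norm[OF assms(1)] hyp_plane_norm[OF assms(2)] by (simp add: hyp_quot_def)
  have "hyp_dist z w = arcosh (1 + 2 * hyp_quot z w)"
    by (simp add: hyp_dist_def hyp_quot_def)
  moreover have "arcosh (1 + 2 * hyp_quot z w) = d \<longleftrightarrow> 1 + 2 * hyp_quot z w = cosh d"
    using q assms(3) cosh_arcosh_real[of "1 + 2 * hyp_quot z w"] by (auto simp: arcosh_cosh_real)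
  moreover have "cosh d = 1 + 2 * (sinh (d / 2))\<^sup>2"
    using cosh_double[of "d / 2"] by (simp add: cosh_square_eq)
  ultimately show ?thesis by auto
qed

section \<open>Moving the centre of a circle to the origin\<close>

lemma one_minus_cnj_mult_nonzero:
  assumes "c \<in> hyp_plane" "z \<in> hyp_plane"
  shows "1 - cnj c * z \<noteq> 0"
proof
  assume "1 - cnj c * z = 0"
  then have "norm c * norm z = 1"
    by (metis complex_mod_cnj eq_iff_diff_eq_0 norm_mult norm_one)
  moreover have "norm c * norm z < 1 * 1"
    using assms by (intro mult_strict_mono') (auto simp: hyp_plane_def)
  ultimately show False by simp
qed

lemma hyp_centre_norm:
  assumes "c \<in> hyp_plane" "z \<in> hyp_plane"
  shows "1 - (norm (hyp_centre c z))\<^sup>2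
    = (1 - (norm c)\<^sup>2) * (1 - (norm z)\<^sup>2) / (norm (1 - cnj c * z))\<^sup>2"
proof -
  have "(norm (1 - cnj c * z))\<^sup>2 - (norm (z - c))\<^sup>2 = (1 - (norm c)\<^sup>2) * (1 - (norm z)\<^sup>2)"
    unfolding cmod_power2 by (simp add: algebra_simps power2_eq_square)
  moreover have "(norm (1 - cnj c * z))\<^sup>2 \<noteq> 0"
    using one_minus_cnj_mult_nonzero[OF assms] by simp
  ultimately show ?thesis
    by (simp add: hyp_centre_def norm_divide power_divide field_simps)
qed

text \<open>The Moebius map is an isometry: over a common denominator the difference of the images
  has numerator \<open>(z - w) * k\<close>, and all further factors cancel by
  \<open>hyp_centre_norm\<close>.\<close>

lemma hyp_quot_hyp_centre:
  assumes "c \<in> hyp_plane" "z \<in> hyp_plane" "w \<in> hyp_plane"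
  shows "hyp_quot (hyp_centre c z) (hyp_centre c w) = hyp_quot z w"
proof -
  define a b k where "a = 1 - cnj c * z" and "b = 1 - cnj c * w" and "k = 1 - (norm c)\<^sup>2"
  have nz: "a \<noteq> 0" "b \<noteq> 0"
    using one_minus_cnj_mult_nonzero assms by (auto simp: a_def b_def)
  have k: "k \<noteq> 0"
    using hyp_plane_norm[OF assms(1)] by (simp add: k_def)
  have "hyp_centre c z - hyp_centre c w = ((z - c) * b - (w - c) * a) / (a * b)"
    using nz by (simp add: hyp_centre_def diff_frac_eq flip: a_def b_def)
  also have "(z - c) * b - (w - c) * a = (z - w) * of_real k"
    unfolding a_def b_def k_def of_real_diff of_real_1 complex_norm_square by algebra
  finally have "(norm (hyp_centre c z - hyp_centre c w))\<^sup>2 = (norm (z - w))\<^sup>2 * k\<^sup>2 / ((norm a)\<^sup>2 * (norm b)\<^sup>2)"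
    by (simp add: norm_divide norm_mult power_mult_distrib power_divide)
  moreover have "X * k\<^sup>2 / ((norm a)\<^sup>2 * (norm b)\<^sup>2)
      / ((k * u / (norm a)\<^sup>2) * (k * v / (norm b)\<^sup>2)) = X / (u * v)" for X u v :: real
    using nz k by (simp add: power2_eq_square)
  ultimately show ?thesis
    using hyp_centre_norm[OF assms(1,2)] hyp_centre_norm[OF assms(1,3)]
    by (simp add: hyp_quot_def flip: a_def b_def k_def)
qed

lemma hyp_circle_iff:
  assumes "c \<in> hyp_plane" "z \<in> hyp_plane" "0 \<le> r"
  shows "z \<in> hyp_circle c r \<longleftrightarrow> norm (hyp_centre c z) = tanh (r / 2)"
proof -
  define p where "p = (norm (hyp_centre c z))\<^sup>2"
  have c0: "hyp_centre c c = 0"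
    by (simp add: hyp_centre_def)
  have "0 < 1 - p"
    unfolding p_def hyp_centre_norm[OF assms(1,2)]
    using hyp_plane_norm[OF assms(1)] hyp_plane_norm[OF assms(2)]
      one_minus_cnj_mult_nonzero[OF assms(1,2)]
    by (intro divide_pos_pos mult_pos_pos) auto
  then have p: "p < 1"
    by simp
  have "hyp_quot c z = p / (1 - p)"
    using hyp_quot_hyp_centre[OF assms(1,1,2)] by (simp add: c0 hyp_quot_def p_def norm_minus_commute)
  then have "z \<in> hyp_circle c r \<longleftrightarrow> p / (1 - p) = (sinh (r / 2))\<^sup>2"
    using hyp_dist_eq_iff[OF assms] assms(2) by (simp add: hyp_circle_def)
  also have "\<dots> \<longleftrightarrow> p * (cosh (r / 2))\<^sup>2 = (sinh (r / 2))\<^sup>2"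
    using p by (simp add: field_simps cosh_square_eq)
  also have "\<dots> \<longleftrightarrow> p = (tanh (r / 2))\<^sup>2"
    by (simp add: tanh_def power_divide field_simps)
  also have "\<dots> \<longleftrightarrow> norm (hyp_centre c z) = tanh (r / 2)"
    unfolding p_def using assms(3) by (intro power2_eq_iff_nonneg) auto
  finally show ?thesis .
qed

lemma norm_one_minus_cis: "(norm (1 - cis b))\<^sup>2 = 4 * (sin (b / 2))\<^sup>2"
proof -
  have "(norm (1 - cis b))\<^sup>2 = (1 - cos b)\<^sup>2 + (sin b)\<^sup>2"
    by (simp add: cmod_power2)
  also have "\<dots> = 2 * (1 - cos b)"
    using sin_cos_squared_add[of b] by (simp add: power2_diff)
  also have "cos b = 1 - 2 * (sin (b / 2))\<^sup>2"
    using cos_double_sin[of "b / 2"] by simp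
  finally show ?thesis by simp
qed

lemma hyp_circle_chord:
  assumes "c \<in> hyp_plane" "0 < r" "x \<in> hyp_circle c r" "y \<in> hyp_circle c r"
    and b: "hyp_centre c y = cis b * hyp_centre c x" "0 \<le> b" "b \<le> 2 * pi"
    and "0 \<le> d"
  shows "hyp_dist x y = d \<longleftrightarrow> sinh (d / 2) = sinh r * sin (b / 2)"
proof -
  define T where "T = tanh (r / 2)"
  have xy: "x \<in> hyp_plane" "y \<in> hyp_plane"
    using assms(3,4) by (auto simp: hyp_circle_def)
  have nx: "norm (hyp_centre c x) = T"
    using hyp_circle_iff[OF assms(1) xy(1)] assms(2,3) by (simp add: T_def)
  have "norm (hyp_centre c x - hyp_centre c y) = norm (1 - cis b) * T"
  proof -
    have "hyp_centre c x - hyp_centre c y = (1 - cis b) * hyp_centre c x"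
      by (simp add: b(1) algebra_simps)
    then show ?thesis
      by (simp add: norm_mult nx)
  qed
  then have "hyp_quot (hyp_centre c x) (hyp_centre c y) = 4 * (sin (b / 2))\<^sup>2 * T\<^sup>2 / (1 - T\<^sup>2)\<^sup>2"
    unfolding hyp_quot_def by (simp add: b(1) nx norm_mult power_mult_distrib flip: norm_one_minus_cis power2_eq_square)
  also have "1 - T\<^sup>2 = 1 / (cosh (r / 2))\<^sup>2"
    unfolding T_def tanh_def
    by (simp add: power_divide eq_divide_eq left_diff_distrib) (simp add: cosh_square_eq)
  also have "4 * (sin (b / 2))\<^sup>2 * T\<^sup>2 / (1 / (cosh (r / 2))\<^sup>2)\<^sup>2
      = (2 * sinh (r / 2) * cosh (r / 2))\<^sup>2 * (sin (b / 2))\<^sup>2"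
    unfolding T_def tanh_def by (simp add: power_divide field_simps power2_eq_square)
  also have "2 * sinh (r / 2) * cosh (r / 2) = sinh r"
    using sinh_double[of "r / 2"] by simp
  finally have "hyp_quot x y = (sinh r * sin (b / 2))\<^sup>2"
    using hyp_quot_hyp_centre[OF assms(1) xy] by (simp add: power_mult_distrib)
  then have "hyp_dist x y = d \<longleftrightarrow> (sinh r * sin (b / 2))\<^sup>2 = (sinh (d / 2))\<^sup>2"
    using hyp_dist_eq_iff[OF xy \<open>0 \<le> d\<close>] by simp
  also have "\<dots> \<longleftrightarrow> sinh r * sin (b / 2) = sinh (d / 2)"
    using assms sin_ge_zero[of "b / 2"] by (intro power2_eq_iff_nonneg) auto
  finally show ?thesis by auto
qed

text \<open>\<open>b i\<close> is the counterclockwise turn from vertex \<open>i - 1\<close> to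
  vertex \<open>i\<close>, and \<open>f i\<close> the accumulated turn from vertex 0. The arc
  condition keeps \<open>f\<close> below a full turn, which is why the half turns add up to \<pi>
  and not to a larger multiple.\<close>

lemma cyclic_ngon_imp_angles:
  assumes poly: "cyclic_ngon n d c r x" and n: "2 \<le> n" and d: "\<And>k. k < n \<Longrightarrow> 0 < d k"
  shows "\<exists>t. (\<forall>k<n. 0 < t k \<and> t k < pi \<and> sinh (d k / 2) = sinh r * sin (t k)) \<and> (\<Sum>k<n. t k) = pi"
proof -
  have c: "c \<in> hyp_plane" and r: "0 < r" and circ: "\<And>i. i < n \<Longrightarrow> x i \<in> hyp_circle c r"
    and arc: "\<And>i j. 1 \<le> i \<Longrightarrow> i < n \<Longrightarrow> j < n \<Longrightarrow> j \<noteq> i \<Longrightarrow> x j \<notin> ccw_arc c (x (i - 1)) (x i)"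
    and side: "\<And>i. 1 \<le> i \<Longrightarrow> i < n \<Longrightarrow> hyp_dist (x (i - 1)) (x i) = d i"
    and side0: "hyp_dist (x (n - 1)) (x 0) = d 0"
    using poly unfolding cyclic_ngon_def by auto
  define w where "w i = hyp_centre c (x i)" for i
  have norm_w: "norm (w i) = tanh (r / 2)" if "i < n" for i
    using hyp_circle_iff[OF c, of "x i" r] circ[OF that] r by (auto simp: w_def hyp_circle_def)
  have w_nz: "w i \<noteq> 0" if "i < n" for i
    using norm_w[OF that] r by auto
  define b where "b i = Arg2pi (w i / w (i - 1))" for i
  have b: "0 \<le> b i" "b i < 2 * pi" for i
    using Arg2pi[of "w i / w (i - 1)"] by (auto simp: b_def)
  have wb: "w i = cis (b i) * w (i - 1)" if "1 \<le> i" "i < n" for i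
  proof -
    have "norm (w i / w (i - 1)) = 1"
      using that norm_w r by (simp add: norm_divide)
    then have "w i / w (i - 1) = cis (b i)"
      using Arg2pi_eq[of "w i / w (i - 1)"] by (simp add: b_def cis_conv_exp)
    then show ?thesis
      using w_nz[of "i - 1"] that by (simp add: field_simps)
  qed
  have chord: "sinh (d i / 2) = sinh r * sin (b i / 2)" if "1 \<le> i" "i < n" for i
    using hyp_circle_chord[OF c r circ[of "i - 1"] circ[of i] wb[OF that, unfolded w_def], of "d i"]
      b[of i] side[OF that] d[of i] that by auto
  have b_pos: "0 < b i" if "1 \<le> i" "i < n" for i
    using chord[OF that] d[of i] that b(1)[of i] by (cases "b i = 0") auto
  define f where "f i = (\<Sum>k\<in>{1..i}. b k)" for i
  have f_Suc: "f (Suc i) = f i + b (Suc i)" for i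
    by (simp add: f_def)
  have wf: "w i = cis (f i) * w 0" if "i < n" for i
    using that
  proof (induction i)
    case (Suc i)
    then show ?case
      using wb[of "Suc i"] by (simp add: f_Suc mult.assoc[symmetric] cis_mult add.commute)
  qed (simp add: f_def)
  have f_less: "f i < 2 * pi" if "i < n" for i
    using that
  proof (induction i)
    case (Suc i)
    show ?case
    proof (rule ccontr)
      \<comment> \<open>Reaching or passing a full turn in this step would put \<open>x 0\<close> on
        the arc that ends at \<open>x (Suc i)\<close>, closed at that end.\<close>
      assume ge: "\<not> f (Suc i) < 2 * pi"
      have "cis (2 * pi - f i) * w i = w 0"
        using wf[of i] Suc.prems by (simp add: mult.assoc[symmetric] cis_mult)
      then have "0 < 2 * pi - f i \<and> 2 * pi - f i \<le> b (Suc i) \<and> b (Suc i) < 2 * pi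
          \<and> w 0 = cis (2 * pi - f i) * w i \<and> w (Suc i) = cis (b (Suc i)) * w i"
        using ge Suc b[of "Suc i"] wb[of "Suc i"] by (simp add: f_Suc)
      moreover have "x 0 \<in> hyp_plane"
        using circ[of 0] Suc.prems by (simp add: hyp_circle_def)
      ultimately have "x 0 \<in> ccw_arc c (x (Suc i - 1)) (x (Suc i))"
        unfolding ccw_arc_def w_def diff_Suc_1 by blast
      then show False
        using arc[of "Suc i" 0] Suc.prems by simp
    qed
  qed (simp add: f_def)
  \<comment> \<open>The closing side, which carries the index 0, turns through the rest of the
    circle.\<close>
  define b0 where "b0 = 2 * pi - f (n - 1)"
  have "0 < f (n - 1)"
    unfolding f_def using n b_pos by (intro sum_pos) auto
  then have b0: "0 < b0" "b0 < 2 * pi"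
    using f_less[of "n - 1"] n by (auto simp: b0_def)
  have "w 0 = cis b0 * w (n - 1)"
    using wf[of "n - 1"] n by (simp add: b0_def mult.assoc[symmetric] cis_mult)
  then have chord0: "sinh (d 0 / 2) = sinh r * sin (b0 / 2)"
    using hyp_circle_chord[OF c r circ[of "n - 1"] circ[of 0], of b0 "d 0"] side0 d[of 0] n b0
    by (auto simp: w_def)
  define t where "t k = (if k = 0 then b0 / 2 else b k / 2)" for k
  have "{..<n} = insert 0 {1..n - 1}"
    using n by auto
  then have "(\<Sum>k<n. t k) = t 0 + (\<Sum>k\<in>{1..n - 1}. t k)"
    by simp
  also have "(\<Sum>k\<in>{1..n - 1}. t k) = f (n - 1) / 2"
    unfolding f_def sum_divide_distrib by (rule sum.cong) (auto simp: t_def)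
  finally have "(\<Sum>k<n. t k) = pi"
    by (simp add: t_def b0_def field_simps)
  moreover have "0 < t k \<and> t k < pi \<and> sinh (d k / 2) = sinh r * sin (t k)" if "k < n" for k
    using that b0 b[of k] b_pos[of k] chord[of k] chord0 by (auto simp: t_def)
  ultimately show ?thesis by blast
qed

lemma cis_eq_imp_eq:
  assumes "cis a = cis b" "0 \<le> a" "a < 2 * pi" "0 \<le> b" "b < 2 * pi"
  shows "a = b"
  using assms Arg2pi_unique[of 1 a "cis a"] Arg2pi_unique[of 1 b "cis b"] by (simp add: cis_conv_exp)

text \<open>Vertices are placed around the origin at the accumulated arguments \<open>f i\<close>.
  The sum in \<open>f\<close> starts at 1 because \<open>t 0\<close> is reserved for the closing
  side.\<close>

lemma angles_imp_cyclic_ngon: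
  assumes r: "0 < r" and n: "2 \<le> n" and d: "\<And>k. k < n \<Longrightarrow> 0 < d k"
    and t: "\<And>k. k < n \<Longrightarrow> 0 < t k \<and> t k < pi \<and> sinh (d k / 2) = sinh r * sin (t k)"
    and sum: "(\<Sum>k<n. t k) = pi"
  shows "\<exists>x. cyclic_ngon n d 0 r x"
proof -
  define R where "R = tanh (r / 2)"
  have R: "0 < R" "R < 1"
    using r tanh_real_lt_1 by (auto simp: R_def)
  define f where "f i = (\<Sum>k\<in>{1..i}. 2 * t k)" for i
  define x where "x i = of_real R * cis (f i)" for i
  have "{..<n} = insert 0 {1..n - 1}"
    using n by auto
  then have "pi = t 0 + (\<Sum>k\<in>{1..n - 1}. t k)"
    using sum by simp
  then have f_last: "f (n - 1) = 2 * pi - 2 * t 0"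
    by (simp add: f_def flip: sum_distrib_left)
  have f_step: "f i = f (i - 1) + 2 * t i" if "1 \<le> i" for i
    using that by (cases i) (auto simp: f_def)
  have f_mono: "f i < f j" if "i < j" "j < n" for i j
    unfolding f_def using that t by (intro sum_strict_mono2[of _ _ j]) (auto intro: less_imp_le)
  have f_nonneg: "0 \<le> f i" if "i < n" for i
    unfolding f_def using that t by (intro sum_nonneg) (auto intro: less_imp_le)
  have f_less: "f i < 2 * pi" if "i < n" for i
  proof -
    have "i < n - 1 \<or> i = n - 1"
      using that by auto
    then show ?thesis
      using f_mono[of i "n - 1"] f_last t[of 0] n by auto
  qed
  have plane: "0 \<in> hyp_plane" "x i \<in> hyp_plane" for i
    using R by (auto simp: hyp_plane_def x_def norm_mult)
  have centre: "hyp_centre 0 z = z" for z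
    by (simp add: hyp_centre_def)
  have circ: "x i \<in> hyp_circle 0 r" for i
    using hyp_circle_iff[OF plane, of r i] R r by (simp add: centre x_def norm_mult flip: R_def)
  have "cyclic_ngon n d 0 r x"
    unfolding cyclic_ngon_def
  proof (intro conjI ballI allI impI plane r circ)
    fix i assume i: "i \<in> {1..<n}"
    have step: "x i = cis (2 * t i) * x (i - 1)"
      using f_step[of i] i by (simp add: x_def cis_mult add.commute mult.left_commute[of "cis _"])
    show "hyp_dist (x (i - 1)) (x i) = d i"
      using hyp_circle_chord[OF plane(1) r circ circ, of i "2 * t i" "i - 1" "d i"] step t[of i] d[of i] i
      by (auto simp: centre)
    fix j assume j: "j < n" "j \<noteq> i"
    show "x j \<notin> ccw_arc 0 (x (i - 1)) (x i)"
    proof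
      assume "x j \<in> ccw_arc 0 (x (i - 1)) (x i)"
      then obtain \<alpha> \<beta> where ab: "0 < \<alpha>" "\<alpha> \<le> \<beta>" "\<beta> < 2 * pi"
        "x j = cis \<alpha> * x (i - 1)" "x i = cis \<beta> * x (i - 1)"
        unfolding ccw_arc_def centre by blast
      have "x (i - 1) \<noteq> 0"
        using R by (simp add: x_def)
      then have "cis \<beta> = cis (2 * t i)"
        using ab(5) step by simp
      then have "\<beta> = 2 * t i"
        using ab t[of i] i by (intro cis_eq_imp_eq) auto
      then have range: "f (i - 1) < f (i - 1) + \<alpha>" "f (i - 1) + \<alpha> \<le> f i"
        using ab(1,2) f_step[of i] i by auto
      have "cis (f j) = cis (f (i - 1) + \<alpha>)"
        using ab(4) R by (simp add: x_def cis_mult[symmetric] mult.commute)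
      \<comment> \<open>Arguments in \<open>[0, 2 * pi)\<close> are unique, so \<open>f j\<close>
        lies above \<open>f (i - 1)\<close> and not above \<open>f i\<close>, which strict growth of
        \<open>f\<close> rules out for \<open>j \<noteq> i\<close>.\<close>
      then have "f j = f (i - 1) + \<alpha>"
        using range f_nonneg[of j] f_less[of j] f_nonneg[of "i - 1"] f_less[of i] i j
        by (intro cis_eq_imp_eq) auto
      show False
      proof -
        consider "j < i - 1" | "j = i - 1" | "i < j"
          using j(2) i by force
        then show False
        proof cases
          case 1
          moreover have "i - 1 < n"
            using i by auto
          ultimately show False
            using range \<open>f j = f (i - 1) + \<alpha>\<close> f_mono[of j "i - 1"] i by auto
        next
          case 2
          then show False
            using range \<open>f j = f (i - 1) + \<alpha>\<close> by simp
        next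
          case 3
          then show False
            using range \<open>f j = f (i - 1) + \<alpha>\<close> f_mono[of i j] j by simp
        qed
      qed
    qed
  next
    have "x 0 = cis (2 * t 0) * x (n - 1)"
      using f_last by (simp add: x_def cis_mult f_def mult.left_commute[of "cis _"])
    then show "hyp_dist (x (n - 1)) (x 0) = d 0"
      using hyp_circle_chord[OF plane(1) r circ circ, of 0 "2 * t 0" "n - 1" "d 0"] t[of 0] d[of 0] n
      by (auto simp: centre)
  qed
  then show ?thesis by blast
qed

text \<open>Angles are transported along \<open>e\<close>. The right-hand side mentions neither
  \<open>e\<close> nor an order of the sides; this is the source of the symmetry of
  \<open>J\<close>.\<close>

lemma is_circumradius_iff:
  fixes e :: "nat \<Rightarrow> 'n::finite"
  assumes n: "CARD('n) \<ge> 3" and e: "bij_betw e {..<CARD('n)} UNIV" and d: "\<And>i. 0 < d $ i"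
  shows "is_circumradius e d r \<longleftrightarrow> 0 < r \<and> (\<exists>t. inscribed (half_sinh d) (sinh r) t)"
proof
  assume "is_circumradius e d r"
  then obtain c x where x: "cyclic_ngon CARD('n) (\<lambda>k. d $ e k) c r x"
    by (auto simp: is_circumradius_def)
  then obtain t where t: "\<And>k. k < CARD('n) \<Longrightarrow> 0 < t k \<and> t k < pi \<and> sinh (d $ e k / 2) = sinh r * sin (t k)"
    "(\<Sum>k<CARD('n). t k) = pi"
    using cyclic_ngon_imp_angles[OF x] n d by auto
  have r: "0 < r"
    using x by (simp add: cyclic_ngon_def)
  define u where "u i = t (inv_into {..<CARD('n)} e i)" for i
  have ue: "u (e k) = t k" if "k < CARD('n)" for k
    using that e by (simp add: u_def bij_betw_def)
  have "sum u UNIV = (\<Sum>k<CARD('n). u (e k))"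
    by (rule sum.reindex_bij_betw[OF e, symmetric])
  then have "sum u UNIV = pi"
    using t(2) ue by simp
  moreover have "0 < u i \<and> u i < pi \<and> sinh (d $ i / 2) = sinh r * sin (u i)" for i
  proof -
    obtain k where "k < CARD('n)" "i = e k"
      using e by (auto simp: bij_betw_def)
    then show ?thesis
      using t(1) ue by auto
  qed
  ultimately have "inscribed (half_sinh d) (sinh r) u"
    using r by (simp add: inscribed_def half_sinh_def)
  then show "0 < r \<and> (\<exists>t. inscribed (half_sinh d) (sinh r) t)"
    using r by blast
next
  assume "0 < r \<and> (\<exists>t. inscribed (half_sinh d) (sinh r) t)"
  then obtain t where r: "0 < r" and t: "inscribed (half_sinh d) (sinh r) t"
    by blast
  have "(\<Sum>k<CARD('n). t (e k)) = pi"
    using inscribedD(4)[OF t] sum.reindex_bij_betw[OF e, of t] by simp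
  then have "\<exists>x. cyclic_ngon CARD('n) (\<lambda>k. d $ e k) 0 r x"
    using n d r inscribedD(2,3)[OF t] inscribedD(5)[OF t]
    by (intro angles_imp_cyclic_ngon[where t = "\<lambda>k. t (e k)"]) (auto simp: half_sinh_def)
  then show "is_circumradius e d r"
    by (auto simp: is_circumradius_def)
qed

section \<open>Well-definedness and symmetry of \<open>J\<close>\<close>

lemma is_circumradius_eq_radius:
  fixes e :: "nat \<Rightarrow> 'n::finite"
  assumes n: "CARD('n) \<ge> 3" and e: "bij_betw e {..<CARD('n)} UNIV" and d: "d \<in> AC"
  shows "0 < radius d" "is_circumradius e d r \<longleftrightarrow> r = radius d" "J e d = radius d"
proof -
  note ins = half_sinh_inscribed[OF n d]
  show pos: "0 < radius d"
    using inscribedD(1)[OF ins] by simp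
  have d0: "0 < d $ i" for i
    using d by (simp add: AC_def)
  show *: "is_circumradius e d r \<longleftrightarrow> r = radius d" for r
  proof
    assume "is_circumradius e d r"
    then obtain t where "inscribed (half_sinh d) (sinh r) t"
      using is_circumradius_iff[OF n e d0] by blast
    then have "sinh r = sinh (radius d)"
      using inscribed_unique[OF n ins] by blast
    then show "r = radius d"
      by (simp only: sinh_real_eq_iff)
  next
    assume "r = radius d"
    then show "is_circumradius e d r"
      using is_circumradius_iff[OF n e d0] pos ins by blast
  qed
  then show "J e d = radius d"
    by (simp add: J_def)
qed

text \<open>Permuting the angles along with the sides shows that both collections have the same
  circumradii, so the two \<open>THE\<close> terms agree.\<close>

lemma J_permute:
  fixes e :: "nat \<Rightarrow> 'n::finite"
  assumes n: "CARD('n) \<ge> 3" and e: "bij_betw e {..<CARD('n)} UNIV" and d: "\<And>i. 0 < d $ i"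
    and p: "bij p"
  shows "J e (\<chi> i. d $ p i) = J e d"
proof -
  have "inscribed (half_sinh (\<chi> i. d $ p i)) R (t \<circ> p)" if "inscribed (half_sinh d) R t" for R t
    using that sum.reindex_bij_betw[OF p, of t] by (auto simp: inscribed_def half_sinh_def)
  moreover have "inscribed (half_sinh d) R (t \<circ> inv p)" if "inscribed (half_sinh (\<chi> i. d $ p i)) R t" for R t
  proof -
    have "p (inv p i) = i" for i
      using p by (simp add: bij_is_surj surj_f_inv_f)
    then show ?thesis
      using that sum.reindex_bij_betw[OF bij_imp_bij_inv[OF p], of t]
      by (auto simp: inscribed_def half_sinh_def) metis
  qed
  moreover have d': "0 < (\<chi> i. d $ p i) $ i" for i
    by (simp add: d)
  ultimately have "is_circumradius e (\<chi> i. d $ p i) r \<longleftrightarrow> is_circumradius e d r" for r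
    unfolding is_circumradius_iff[OF n e d] is_circumradius_iff[OF n e d']
    by blast
  then show ?thesis
    by (simp add: J_def)
qed

section \<open>Estimates for the partial derivatives\<close>

text \<open>The upper bound is \<open>d / 2 < r\<close>, half a chord against the radius. The lower
  one is \<open>cosh (d / 2)^2 - s^2 * cosh r^2 = 1 - s^2 > 0\<close>.\<close>

lemma cosh_half_bounds:
  assumes "0 < r" "0 < d" "sinh (d / 2) = sinh r * s" "0 < s" "s < (1::real)"
  shows "cosh (d / 2) < cosh r" "s * cosh r < cosh (d / 2)"
proof -
  have "sinh r * s < sinh r * 1"
    using assms by (intro mult_strict_left_mono) auto
  then have "sinh (d / 2) < sinh r"
    using assms(3) by simp
  then have "d / 2 < r"
    by (simp only: sinh_real_less_iff)
  then show "cosh (d / 2) < cosh r"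
    using assms(1,2) by (subst cosh_real_nonneg_less_iff) auto
  have "s\<^sup>2 < 1"
    using assms(4,5) by (simp add: power_strict_decreasing abs_square_less_1)
  then have "(s * cosh r)\<^sup>2 < (cosh (d / 2))\<^sup>2"
    by (simp add: power_mult_distrib cosh_square_eq assms(3) algebra_simps)
  then show "s * cosh r < cosh (d / 2)"
    by (rule power2_less_imp_less) simp
qed

section \<open>\<open>C\<close> and \<open>BC\<close> in terms of the angle at a longest
  side\<close>

lemma maximal_side:
  fixes d :: "real ^ 'n::finite"
  shows "d $ m = max_side d \<longleftrightarrow> (\<forall>i. d $ i \<le> d $ m)"
proof -
  have "Max (range (\<lambda>i. d $ i)) = d $ m \<longleftrightarrow> d $ m \<in> range (\<lambda>i. d $ i) \<and> (\<forall>a\<in>range (\<lambda>i. d $ i). a \<le> d $ m)"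
    by (rule Max_eq_iff) auto
  then show ?thesis
    by (auto simp: max_side_def)
qed

lemma theta_sum:
  fixes d :: "real ^ 'n::finite"
  assumes "d $ m = max_side d"
  shows "(\<Sum>i\<in>UNIV. theta (d $ i) (max_side d / 2))
    = 2 * (\<Sum>i\<in>UNIV. arcsin (half_sinh d $ i / half_sinh d $ m))"
  by (simp add: theta_def half_sinh_def sum_distrib_left flip: assms)

lemma AC_cases:
  fixes d :: "real ^ 'n::finite"
  assumes n: "CARD('n) \<ge> 3" and d: "d \<in> AC" and m: "d $ m = max_side d"
  shows "d \<in> C \<longleftrightarrow> angle d m < pi / 2" "d \<in> BC \<longleftrightarrow> angle d m = pi / 2"
    "j \<noteq> m \<Longrightarrow> angle d j < pi / 2"
proof -
  note ins = half_sinh_inscribed[OF n d]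
  have max: "half_sinh d $ i \<le> half_sinh d $ m" for i
    using m by (simp add: maximal_side half_sinh_def)
  have "half_sinh d $ m < (\<Sum>j\<in>UNIV - {m}. half_sinh d $ j)"
    using d by (simp add: AC_def half_sinh_def)
  note * = inscribed_max_angle[OF n ins max this]
  show "d \<in> C \<longleftrightarrow> angle d m < pi / 2" "d \<in> BC \<longleftrightarrow> angle d m = pi / 2"
    unfolding * using d theta_sum[OF m] by (auto simp: AC_def C_def BC_def)
  show "j \<noteq> m \<Longrightarrow> angle d j < pi / 2"
    by (rule inscribed_max_acute[OF n ins max])
qed

lemma one_less_sin_plus_cos:
  assumes "0 < x" "x < pi / 2"
  shows "1 < sin x + cos x"
proof -
  have "0 < sin x" "0 < cos x"
    using assms by (auto intro: sin_gt_zero cos_gt_zero)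
  then have "1\<^sup>2 < (sin x + cos x)\<^sup>2"
    using sin_cos_squared_add[of x] by (simp add: power2_sum)
  then show ?thesis
    using \<open>0 < sin x\<close> \<open>0 < cos x\<close> power2_less_imp_less[of 1 "sin x + cos x"] by simp
qed

lemma le_tan:
  assumes "0 \<le> x" "x < pi / 2"
  shows "x \<le> tan x"
proof -
  have "((\<lambda>x. tan x - x) has_real_derivative inverse ((cos y)\<^sup>2) - 1) (at y)
      \<and> inverse ((cos y)\<^sup>2) - 1 \<ge> 0" if "0 \<le> y" "y \<le> x" for y
  proof -
    have "0 < cos y"
      using that assms by (intro cos_gt_zero_pi) auto
    moreover have "(cos y)\<^sup>2 \<le> 1"
      by (simp add: abs_square_le_1)
    ultimately show ?thesis
      by (auto intro!: derivative_eq_intros one_le_inverse)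
  qed
  then have "tan 0 - 0 \<le> tan x - x"
    by (intro DERIV_nonneg_imp_nondecreasing[OF assms(1), of "\<lambda>x. tan x - x"]) blast
  then show ?thesis
    by simp
qed

text \<open>Tangents dominate angles, and the other angles add up to
  \<open>pi - angle d i > 1\<close>; so the denominator exceeds \<open>sin + cos\<close> of an acute
  angle.\<close>

lemma denom_greater_one:
  fixes d :: "real ^ 'n::finite"
  assumes n: "CARD('n) \<ge> 3" and d: "d \<in> AC" and acute: "\<And>j. angle d j < pi / 2"
  shows "1 < denom i d"
proof -
  note ins = half_sinh_inscribed[OF n d]
  have pos: "0 < angle d j" for j
    by (rule inscribedD(2)[OF ins])
  have "1 < pi - angle d i"
    using acute[of i] pi_gt3 by simp
  also have "\<dots> = (\<Sum>j\<in>UNIV - {i}. angle d j)"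
    using inscribedD(8)[OF ins] by simp
  also have "\<dots> \<le> (\<Sum>j\<in>UNIV - {i}. tan (angle d j))"
    using pos acute by (intro sum_mono) (auto intro!: le_tan less_imp_le[OF pos])
  finally have "cos (angle d i) * 1 < cos (angle d i) * (\<Sum>j\<in>UNIV - {i}. tan (angle d j))"
    using pos acute by (intro mult_strict_left_mono cos_gt_zero)
  then show ?thesis
    using one_less_sin_plus_cos[OF pos acute, of i] by (simp add: denom_def)
qed

section \<open>Signs and sizes of the partial derivatives\<close>

context
  fixes f :: "real ^ 'n::finite \<Rightarrow> real" and d :: "real ^ 'n"
  assumes n: "CARD('n) \<ge> 3" and f: "\<And>d. d \<in> AC \<Longrightarrow> f d = radius d"
    and d: "d \<in> AC"
begin

private lemma ins: "inscribed (half_sinh d) (sinh (radius d)) (angle d)"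
  by (rule half_sinh_inscribed[OF n d])

private lemma facts:
  "0 < radius d" "0 < d $ i" "0 < angle d i" "angle d i < pi" "0 < sin (angle d i)"
  "sinh (d $ i / 2) = sinh (radius d) * sin (angle d i)"
  using d inscribedD(1)[OF ins] inscribedD(2,3,5,6)[OF ins, of i] by (auto simp: AC_def half_sinh_def)

private lemma sin_less_one: "angle d i \<noteq> pi / 2 \<Longrightarrow> sin (angle d i) < 1"
  using sin_monotone_2pi[of "angle d i" "pi / 2"] sin_monotone_2pi[of "pi - angle d i" "pi / 2"]
    facts(3,4)[of i] by (cases "angle d i < pi / 2") auto

text \<open>All angles are acute, so \<open>i\<close> itself can be singled out; then
  \<open>cosh (d $ i / 2) < cosh (radius d)\<close> and \<open>denom i d > 1\<close> bound the
  quotient.\<close>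

lemma partial_deriv_radius_C:
  assumes "d \<in> C"
  shows "0 < partial_deriv i f d" "partial_deriv i f d < 1 / 2"
proof -
  obtain k where k: "d $ k = max_side d"
    using ex_maximal_index[of "($) d"] by (auto simp: maximal_side)
  have acute: "angle d j < pi / 2" for j
    using AC_cases[OF n d k] assms by (cases "j = k") auto
  have pd: "partial_deriv i f d = cosh (d $ i / 2) / cosh (radius d) / (2 * denom i d)"
    by (rule partial_deriv_radius(1)[OF n f d acute])
  have D: "1 < denom i d"
    by (rule denom_greater_one[OF n d acute])
  then show "0 < partial_deriv i f d"
    by (simp add: pd)
  have "cosh (d $ i / 2) < cosh (radius d)"
    using cosh_half_bounds[OF facts(1,2,6,5) sin_less_one] acute[of i] by simp
  also have "\<dots> < cosh (radius d) * denom i d"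
    using D by simp
  finally have "cosh (d $ i / 2) / (cosh (radius d) * denom i d) < 1"
    using D by (subst divide_less_eq_1_pos) auto
  then show "partial_deriv i f d < 1 / 2"
    by (simp add: pd)
qed

text \<open>Now \<open>cos (angle d m) < 0\<close>. This lowers \<open>denom m d\<close> to at most
  \<open>sin (angle d m)\<close>, which the lower bound on \<open>cosh (d $ m / 2)\<close> beats,
  and it is the sign-giving factor of all other derivatives.\<close>

lemma partial_deriv_radius_obtuse:
  assumes "d \<notin> C \<union> BC" and m: "d $ m = max_side d"
  shows "partial_deriv m f d > 1 / 2" "j \<noteq> m \<Longrightarrow> partial_deriv j f d < 0"
proof -
  note cases = AC_cases[OF n d m]
  have obtuse: "pi / 2 < angle d m"
    using assms(1) cases(1,2) by auto
  have cm: "cos (angle d m) < 0"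
    using obtuse facts(4)[of m] by (intro cos_lt_zero_pi) auto
  have D: "0 < denom m d"
    unfolding denom_def by (rule inscribed_denominator_pos[OF n ins cases(3)])
  have "0 \<le> (\<Sum>j\<in>UNIV - {m}. tan (angle d j))"
    using cases(3) facts(3) by (intro sum_nonneg less_imp_le[OF tan_gt_zero]) auto
  then have "denom m d \<le> sin (angle d m)"
    using cm by (simp add: denom_def mult_nonpos_nonneg)
  then have "cosh (radius d) * denom m d \<le> sin (angle d m) * cosh (radius d)"
    by (simp add: mult.commute)
  also have "\<dots> < cosh (d $ m / 2)"
    using cosh_half_bounds(2)[OF facts(1,2,6,5) sin_less_one] obtuse by simp
  finally have "1 < cosh (d $ m / 2) / (cosh (radius d) * denom m d)"
    using D by (subst less_divide_eq_1_pos) auto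
  then show "partial_deriv m f d > 1 / 2"
    by (simp add: partial_deriv_radius(1)[OF n f d cases(3)])
  assume "j \<noteq> m"
  then have "0 < cos (angle d j)"
    using cases(3) facts(3) by (intro cos_gt_zero) auto
  then show "partial_deriv j f d < 0"
    using \<open>j \<noteq> m\<close> D cm
    by (subst partial_deriv_radius(2)[OF n f d cases(3)]) (auto intro!: divide_neg_pos mult_neg_pos)
qed

text \<open>A longer side has a larger \<open>cosh\<close> and a smaller absolute cosine of its
  angle. Off \<open>m\<close> all derivatives share the factor \<open>cos (angle d m)\<close>, which
  vanishes on \<open>BC\<close>; two shorter sides then both have derivative 0, so strictness needs
  the extra condition.\<close>

lemma partial_deriv_radius_compare:
  assumes less: "d $ j < d $ i"
  shows "\<bar>partial_deriv j f d\<bar> \<le> \<bar>partial_deriv i f d\<bar>"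
    and "d \<notin> BC \<or> d $ i = max_side d \<Longrightarrow> \<bar>partial_deriv j f d\<bar> < \<bar>partial_deriv i f d\<bar>"
proof -
  obtain m where m: "d $ m = max_side d"
    using ex_maximal_index[of "($) d"] by (auto simp: maximal_side)
  note cases = AC_cases[OF n d m]
  define K where "K = 2 * denom m d * cosh (radius d)"
  have D: "0 < denom m d"
    unfolding denom_def by (rule inscribed_denominator_pos[OF n ins cases(3)])
  then have K: "0 < K"
    by (simp add: K_def)
  have cpos: "0 < cos (angle d k)" if "k \<noteq> m" for k
    using cases(3)[OF that] facts(3) by (intro cos_gt_zero) auto
  have "j \<noteq> m"
    using less m maximal_side[of d m] by (metis not_less)
  have pj: "\<bar>partial_deriv j f d\<bar> = \<bar>cos (angle d m)\<bar> * (cosh (d $ j / 2) / cos (angle d j)) / K"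
    using cpos[OF \<open>j \<noteq> m\<close>] D
    by (simp add: partial_deriv_radius(2)[OF n f d cases(3) \<open>j \<noteq> m\<close>] abs_mult K_def)
  have cosh: "cosh (d $ j / 2) < cosh (d $ i / 2)"
    using less facts(2)[of i] facts(2)[of j] by (subst cosh_real_nonneg_less_iff) auto
  have "sinh (radius d) * sin (angle d j) < sinh (radius d) * sin (angle d i)"
    unfolding facts(6)[symmetric] using less by simp
  then have "sin (angle d j) < sin (angle d i)"
    using facts(1) by simp
  then have "(sin (angle d j))\<^sup>2 < (sin (angle d i))\<^sup>2"
    using facts(5)[of j] by (intro power_strict_mono) auto
  then have "(cos (angle d i))\<^sup>2 < (cos (angle d j))\<^sup>2"
    by (simp add: cos_squared_eq)
  \<comment> \<open>The absolute value is there for \<open>i = m\<close>, whose angle may be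
    obtuse.\<close>
  then have cos: "\<bar>cos (angle d i)\<bar> < cos (angle d j)"
    using cpos[OF \<open>j \<noteq> m\<close>] power2_less_imp_less[of "\<bar>cos (angle d i)\<bar>" "cos (angle d j)"] by simp
  have main: "\<bar>partial_deriv j f d\<bar> < \<bar>partial_deriv i f d\<bar>" if "i = m \<or> cos (angle d m) \<noteq> 0"
  proof (cases "i = m")
    case True
    have "\<bar>cos (angle d m)\<bar> / cos (angle d j) * cosh (d $ j / 2) \<le> 1 * cosh (d $ j / 2)"
      using cos True cpos[OF \<open>j \<noteq> m\<close>] by (intro mult_right_mono) auto
    also have "\<dots> < cosh (d $ m / 2)"
      using cosh True by simp
    finally have "\<bar>cos (angle d m)\<bar> * (cosh (d $ j / 2) / cos (angle d j)) / K < cosh (d $ m / 2) / K"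
      using K by (intro divide_strict_right_mono) auto
    also have "\<dots> = \<bar>partial_deriv i f d\<bar>"
      using D True by (simp add: partial_deriv_radius(1)[OF n f d cases(3)] K_def ac_simps)
    finally show ?thesis
      using pj by simp
  next
    case False
    have "cosh (d $ j / 2) / cos (angle d j) < cosh (d $ i / 2) / cos (angle d i)"
      using cosh cos cpos[OF False] by (intro frac_less) auto
    then have "\<bar>cos (angle d m)\<bar> * (cosh (d $ j / 2) / cos (angle d j)) / K
        < \<bar>cos (angle d m)\<bar> * (cosh (d $ i / 2) / cos (angle d i)) / K"
      using False that K by (intro divide_strict_right_mono mult_strict_left_mono) auto
    also have "\<dots> = \<bar>partial_deriv i f d\<bar>"
      using cpos[OF False] D
      by (simp add: partial_deriv_radius(2)[OF n f d cases(3) False] abs_mult K_def)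
    finally show ?thesis
      using pj by simp
  qed
  then show "\<bar>partial_deriv j f d\<bar> \<le> \<bar>partial_deriv i f d\<bar>"
    using pj by (cases "cos (angle d m) = 0") auto
  assume *: "d \<notin> BC \<or> d $ i = max_side d"
  show "\<bar>partial_deriv j f d\<bar> < \<bar>partial_deriv i f d\<bar>"
  proof (rule main, rule ccontr)
    \<comment> \<open>A right angle at \<open>m\<close> means \<open>d \<in> BC\<close>, so
      \<open>i\<close> is another longest side; taking \<open>i\<close> as the reference index makes
      the angle at \<open>m\<close> acute.\<close>
    assume "\<not> (i = m \<or> cos (angle d m) \<noteq> 0)"
    then have "i \<noteq> m" "cos (angle d m) = 0"
      by auto
    moreover have "angle d m = pi / 2"
      using calculation(2) facts(3,4)[of m] cos_gt_zero[of "angle d m"] cos_lt_zero_pi[of "angle d m"]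
      by (cases "angle d m" "pi / 2" rule: linorder_cases) auto
    ultimately have "d $ i = max_side d" "angle d i < pi / 2"
      using * cases(2,3) by auto
    then show False
      using AC_cases(3)[OF n d, of i m] \<open>i \<noteq> m\<close> \<open>angle d m = pi / 2\<close> by simp
  qed
qed

end

text \<open>The first conjunct gives meaning to the \<open>THE\<close> in \<open>J\<close>. The
  final comparison is strict except between two sides shorter than the maximum at points of
  \<open>BC\<close>, where both derivatives are zero.\<close>

theorem proposition1p14:
  fixes e :: "nat \<Rightarrow> 'n::finite"
  assumes n: "CARD('n) \<ge> 3"
    and e: "bij_betw e {..<CARD('n)} UNIV"
  shows "(\<forall>d\<in>AC. J e d > 0 \<and> (\<forall>r. is_circumradius e d r \<longleftrightarrow> r = J e d))
    \<and> smooth_on AC (J e)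
    \<and> (\<forall>d\<in>AC. \<forall>p::'n \<Rightarrow> 'n. bij p \<longrightarrow> J e (\<chi> i. d $ p i) = J e d)
    \<and> (\<forall>d\<in>AC.
         (d \<in> C \<longrightarrow> (\<forall>i. 0 < partial_deriv i (J e) d \<and> partial_deriv i (J e) d < 1/2))
       \<and> (d \<notin> C \<union> BC \<longrightarrow> (\<forall>i. d $ i = max_side d \<longrightarrow> partial_deriv i (J e) d > 1/2))
       \<and> (d \<notin> C \<union> BC \<longrightarrow> (\<forall>j. d $ j \<noteq> max_side d \<longrightarrow> partial_deriv j (J e) d < 0))
       \<and> (\<forall>i j. d $ i > d $ j \<longrightarrow>
            \<bar>partial_deriv i (J e) d\<bar> \<ge> \<bar>partial_deriv j (J e) d\<bar>
          \<and> (d \<notin> BC \<or> d $ i = max_side d \<longrightarrow>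
               \<bar>partial_deriv i (J e) d\<bar> > \<bar>partial_deriv j (J e) d\<bar>)))"
proof (intro conjI ballI allI impI)
  note circ = is_circumradius_eq_radius[OF n e]
  note J = circ(3)
  show "smooth_on AC (J e)"
    by (rule smooth_on_AC[OF n J])
  fix d :: "real ^ 'n" assume d: "d \<in> AC"
  show "J e d > 0"
    using circ(1)[OF d] J[OF d] by simp
  show "is_circumradius e d r \<longleftrightarrow> r = J e d" for r
    using circ(2)[OF d] J[OF d] by simp
  show "J e (\<chi> i. d $ p i) = J e d" if "bij p" for p :: "'n \<Rightarrow> 'n"
    using d by (intro J_permute[OF n e _ that]) (simp add: AC_def)
  show "0 < partial_deriv i (J e) d" "partial_deriv i (J e) d < 1 / 2" if "d \<in> C" for i
    using partial_deriv_radius_C[OF n J d that] by auto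
  show "partial_deriv i (J e) d > 1 / 2" if "d \<notin> C \<union> BC" "d $ i = max_side d" for i
    by (rule partial_deriv_radius_obtuse(1)[OF n J d that])
  show "partial_deriv j (J e) d < 0" if "d \<notin> C \<union> BC" "d $ j \<noteq> max_side d" for j
  proof -
    obtain m where "d $ m = max_side d"
      using ex_maximal_index[of "($) d"] by (auto simp: maximal_side)
    then show ?thesis
      using that by (intro partial_deriv_radius_obtuse(2)[OF n J d]) auto
  qed
  show "\<bar>partial_deriv i (J e) d\<bar> \<ge> \<bar>partial_deriv j (J e) d\<bar>" if "d $ i > d $ j" for i j
    by (rule partial_deriv_radius_compare(1)[OF n J d that])
  show "\<bar>partial_deriv i (J e) d\<bar> > \<bar>partial_deriv j (J e) d\<bar>"
    if "d $ i > d $ j" "d \<notin> BC \<or> d $ i = max_side d" for i j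
    by (rule partial_deriv_radius_compare(2)[OF n J d that])
qed

end
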